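(* Let $0<a<\frac12$ and $u\in\mathbb{R}$ be fixed, let $n\in\mathbb{N}$, and put $q=\exp(-2\pi n^{-a})$. Then, as $n\to\infty$, $$\frac{1}{\Gamma_q\left(\frac12-n-n^a u\right)}=\frac{2(-1)^n\exp\left(\pi n^{-a}(n^a u+n)^2\right)\cos(\pi n^a u)\left\{1+\mathcal{O}\left(e^{-2\pi n^a}\right)\right\}}{\sqrt{n^a}\,\exp\left(\pi n^a/12+\pi n^{-a}/6\right)\left(1-\exp(-2\pi n^{-a})\right)^{n+n^a u+1/2}},$$ and $$\frac{1}{\Gamma_q\left(\frac12+n+n^a u\right)}=\frac{\exp\left(\pi n^a/12-\pi n^{-a}/12\right)\left\{1+\mathcal{O}\left(e^{-2\pi n^a}\right)\right\}}{\sqrt{n^a}\,\left(1-e^{-2\pi n^{-a}}\right)^{1/2-n-n^a u}}.$$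
   Context: For $0<q<1$, the $q$-Gamma function is $\Gamma_q(x)=\frac{(q;q)_\infty}{(q^x;q)_\infty}(1-q)^{1-x}$, where $(c;q)_\infty=\prod_{k=0}^\infty(1-cq^k)$; its reciprocal $1/\Gamma_q(x)=\frac{(q^x;q)_\infty}{(q;q)_\infty}(1-q)^{x-1}$ is defined for all $x$ (with value $0$ at poles of $\Gamma_q$). Note that $q$ depends on $n$. The $\mathcal{O}$ terms are as $n\to\infty$ with $a,u$ fixed (implied constants may depend on $a,u$). *)

theory Defs
  imports "HOL-Analysis.Infinite_Products" "HOL-Library.Landau_Symbols"
begin

definition qpoch_inf :: "real \<Rightarrow> real \<Rightarrow> real" where
  "qpoch_inf c q = (\<Prod>k. 1 - c * q ^ k)"

text \<open>
  Vanishing factors do not spoil the convergence in the sense of \<^const>\<open>convergent_prod\<close>;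
  the value of the product is then \<open>0\<close>.
\<close>

lemma convergent_prod_qpoch_inf:
  fixes c q :: real
  assumes "0 < q" "q < 1"
  shows "convergent_prod (\<lambda>k. 1 - c * q ^ k)"
proof -
  have "summable (\<lambda>k. norm ((1 - c * q ^ k) - 1))"
    using assms by (simp add: abs_mult power_abs summable_mult summable_geometric)
  then show ?thesis
    by (intro abs_convergent_prod_imp_convergent_prod)
       (simp only: abs_convergent_prod_conv_summable)
qed

definition q_Gamma :: "real \<Rightarrow> real \<Rightarrow> real" where
  "q_Gamma q x = qpoch_inf q q / qpoch_inf (q powr x) q * (1 - q) powr (1 - x)"

text \<open>The reciprocal of \<^const>\<open>q_Gamma\<close>, with value \<open>0\<close> at the poles.\<close>

definition rq_Gamma :: "real \<Rightarrow> real \<Rightarrow> real" where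
  "rq_Gamma q x = qpoch_inf (q powr x) q / qpoch_inf q q * (1 - q) powr (x - 1)"

lemma rq_Gamma_eq_inverse: "rq_Gamma q x = 1 / q_Gamma q x"
  using powr_minus_divide[of "1 - q" "1 - x"] by (simp add: rq_Gamma_def q_Gamma_def)

end

theory Submission
  imports Defs "HOL-Analysis.Analysis" "HOL-Real_Asymp.Real_Asymp"
begin

text \<open>
  Put \<open>t = n\<^sup>a\<close>, so \<open>q = exp (- 2 * pi / t)\<close>, and \<open>m = n + t * u\<close>. The Jacobi triple product writes
  \<open>(q\<^bsup>1/2+m\<^esup>; q) (q\<^bsup>1/2-m\<^esup>; q) (q; q)\<close> as a shifted Gaussian sum with alternating signs, whose theta
  transformation is a cosine series with leading term \<open>cos (pi * m)\<close> and relative error of order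
  \<open>exp (- 2 * pi * t)\<close>; the error stays relative at the zeros of the cosine because
  \<open>cos ((2 * k + 1) * y)\<close> is divisible by \<open>cos y\<close>. The same expansion with \<open>q\<^sup>3\<close> in place of \<open>q\<close> and
  \<open>m = 1/6\<close> gives \<open>(q; q)\<close>, and \<open>(q\<^bsup>1/2+m\<^esup>; q)\<close> is negligibly close to \<open>1\<close> because \<open>a < 1/2\<close>.
\<close>

text \<open>Both series identities, the triple product and the theta transformation, arise from
  finite identities whose two sides converge termwise; dominated convergence over the integers
  carries out the passage to the limit. The first finite identity is the q-binomial theorem, the
  second a filter by roots of unity, a discrete form of Poisson summation. The accuracy of (q; q) is
  the delicate point. Replacing q by q^3 replaces t by t/3, so the generic relative error of theta
  would only be of order exp (- 2 * pi * t / 3). At the shift 1/6, however, the second cosine is cos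
  (pi / 2) = 0, and the third term has relative size exp (- 6 * pi * t / 3). This is why theta is
  expanded to two explicit terms. In the first formula (q; q) enters squared, once through the
  definition of \<open>rq_Gamma\<close> and once through the triple product.\<close>

lemma infsetsum_dominated_convergence:
  fixes f :: "nat \<Rightarrow> 'a \<Rightarrow> real"
  assumes "\<And>x. (\<lambda>n. f n x) \<longlonglongrightarrow> g x" "\<And>n x. \<bar>f n x\<bar> \<le> w x"
    and "integrable (count_space UNIV) w"
  shows "(\<lambda>n. infsetsum (f n) UNIV) \<longlonglongrightarrow> infsetsum g UNIV"
  unfolding infsetsum_def
  by (rule integral_dominated_convergence[where w = w]) (use assms in auto)

section \<open>Summability of Gaussians over the integers\<close>

lemma integrable_power_abs_int:
  fixes r :: real
  assumes "0 \<le> r" "r < 1"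
  shows "integrable (count_space UNIV) (\<lambda>j::int. r ^ nat \<bar>j\<bar>)"
proof -
  have "Infinite_Set_Sum.abs_summable_on (\<lambda>n. r ^ n) (UNIV :: nat set)"
    using assms by (simp add: abs_summable_on_nat_iff' summable_geometric)
  then have "Infinite_Set_Sum.abs_summable_on (\<lambda>j::int. r ^ nat \<bar>j\<bar>) (range int)"
    and "Infinite_Set_Sum.abs_summable_on (\<lambda>j::int. r ^ nat \<bar>j\<bar>) (range (\<lambda>n. - int n))"
    by (auto simp: Infinite_Set_Sum.abs_summable_on_reindex_iff[symmetric] inj_on_def)
  then have "Infinite_Set_Sum.abs_summable_on (\<lambda>j::int. r ^ nat \<bar>j\<bar>) (range int \<union> range (\<lambda>n. - int n))"
    by (rule Infinite_Set_Sum.abs_summable_on_union)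
  moreover have "range int \<union> range (\<lambda>n. - int n) = UNIV"
  proof -
    have "j \<in> range int \<union> range (\<lambda>n. - int n)" for j
      by (cases j rule: int_cases2) auto
    then show ?thesis by blast
  qed
  ultimately show ?thesis by (simp add: Infinite_Set_Sum.abs_summable_on_def)
qed

text \<open>From (|x| - 1)^2 >= 0 one gets x^2 >= 2 * |x| - 1, so the Gaussian lies below a constant
  times a geometric sequence in |j|.\<close>

lemma integrable_gaussian_int:
  fixes c m :: real
  assumes "0 < c"
  shows "integrable (count_space UNIV) (\<lambda>j::int. exp (- c * (of_int j + m)\<^sup>2))"
proof (rule Bochner_Integration.integrable_bound)
  show "integrable (count_space UNIV) (\<lambda>j::int. exp (c * (1 + 2 * \<bar>m\<bar>)) * exp (- 2 * c) ^ nat \<bar>j\<bar>)"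
    using assms by (intro integrable_mult_right integrable_power_abs_int) auto
  show "AE j in count_space UNIV. norm (exp (- c * (of_int j + m)\<^sup>2))
      \<le> norm (exp (c * (1 + 2 * \<bar>m\<bar>)) * exp (- 2 * c) ^ nat \<bar>j\<bar>)"
  proof (rule AE_I2)
    fix j :: int
    have "0 \<le> (\<bar>of_int j + m\<bar> - 1)\<^sup>2" by simp
    then have "2 * \<bar>of_int j + m\<bar> - 1 \<le> (of_int j + m)\<^sup>2"
      by (simp only: power2_diff power2_abs) simp
    then have "2 * \<bar>real_of_int j\<bar> - 2 * \<bar>m\<bar> - 1 \<le> (of_int j + m)\<^sup>2"
      using abs_triangle_ineq2[of "real_of_int j" "- m"] by simp
    then have "c * (2 * \<bar>real_of_int j\<bar> - 2 * \<bar>m\<bar> - 1) \<le> c * (of_int j + m)\<^sup>2"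
      using assms by (intro mult_left_mono) auto
    then show "norm (exp (- c * (of_int j + m)\<^sup>2))
      \<le> norm (exp (c * (1 + 2 * \<bar>m\<bar>)) * exp (- 2 * c) ^ nat \<bar>j\<bar>)"
      by (simp add: exp_of_nat_mult[symmetric] exp_add[symmetric] algebra_simps)
  qed
qed simp

subsection \<open>The Jacobi triple product\<close>

text \<open>The symbol (q; q)_n, which is the usual q-factorial times (1 - q)^n. The factors are
  written \<open>q * q ^ i\<close> so that they are literally those of
  \<open>qpoch_inf q q\<close>.\<close>

definition qfact :: "real \<Rightarrow> nat \<Rightarrow> real" where
  "qfact q n = (\<Prod>i<n. 1 - q * q ^ i)"

text \<open>The Gaussian binomial coefficient; the powers of 1 - q separating \<open>qfact\<close>
  from the q-factorial cancel.\<close>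

definition qbinomial :: "real \<Rightarrow> nat \<Rightarrow> nat \<Rightarrow> real" where
  "qbinomial q n k = (if k \<le> n then qfact q n / (qfact q k * qfact q (n - k)) else 0)"

lemma qfact_Suc: "qfact q (Suc n) = qfact q n * (1 - q ^ Suc n)"
  by (simp add: qfact_def)

context
  fixes q :: real
  assumes q01: "0 < q" "q < 1"
begin

lemma qfact_pos: "0 < qfact q n"
proof (unfold qfact_def, intro prod_pos ballI)
  fix i
  have "q ^ Suc i < 1" using q01 by (intro power_Suc_less_one) auto
  then show "0 < 1 - q * q ^ i" by simp
qed

text \<open>One of the two q-Pascal rules. For k < n, with a = q^(k+1) and b = q^(n-k), it is 1 - a
  * b = (1 - b) + b * (1 - a) over a common denominator.\<close>

lemma qbinomial_Suc_Suc:
  "qbinomial q (Suc n) (Suc k) = qbinomial q n (Suc k) + q ^ (n - k) * qbinomial q n k"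
proof -
  consider "n < k" | "k = n" | "k < n" by linarith
  then show ?thesis
  proof cases
    case 3
    then obtain d where n: "n = Suc (k + d)" using less_imp_Suc_add by blast
    have "q ^ Suc i \<noteq> 1" for i
      using q01 power_Suc_less_one[of q i] by auto
    then have nz: "1 - q ^ Suc i \<noteq> 0" for i by (metis right_minus_eq)
    have e: "qbinomial q (Suc n) (Suc k) = qfact q n * (1 - q ^ Suc n) / (qfact q k * (1 - q ^ Suc k) * (qfact q d * (1 - q ^ Suc d)))"
       "qbinomial q n (Suc k) = qfact q n / (qfact q k * (1 - q ^ Suc k) * qfact q d)"
       "qbinomial q n k = qfact q n / (qfact q k * (qfact q d * (1 - q ^ Suc d)))" "n - k = Suc d"
      using n by (simp_all add: qbinomial_def qfact_Suc Suc_diff_le del: power_Suc)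
    have i: "A * (1 - a * b) / (B * (1 - a) * (C * (1 - b))) = A / (B * (1 - a) * C) + b * (A / (B * (C * (1 - b))))"
      if "B \<noteq> 0" "C \<noteq> 0" "1 - a \<noteq> 0" "1 - b \<noteq> 0" for A B C a b :: real
      using that by (simp add: divide_simps) (simp add: algebra_simps)
    have "q ^ Suc n = q ^ Suc k * q ^ Suc d" using n by (simp add: power_add)
    then show ?thesis unfolding e
      using i[of "qfact q k" "qfact q d" "q ^ Suc k" "q ^ Suc d"] nz qfact_pos[of k] qfact_pos[of d]
      by (metis less_irrefl)
  next
    case 2
    have "qfact q 0 = 1" by (simp add: qfact_def)
    then show ?thesis using 2 qfact_pos[of n] qfact_pos[of "Suc n"]
      by (simp add: qbinomial_def)
  qed (simp add: qbinomial_def)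
qed

lemma qbinomial_theorem:
  "(\<Prod>i<n. 1 - y * q ^ i) = (\<Sum>k\<le>n. (- 1) ^ k * q ^ (k choose 2) * y ^ k * qbinomial q n k)"
proof (induction n)
  case 0
  then show ?case by (simp add: qbinomial_def qfact_def binomial_eq_0)
next
  case (Suc n)
  define a where "a k = (- 1) ^ k * q ^ (k choose 2) * y ^ k" for k
  have a0: "qbinomial q m 0 = 1" for m using qfact_pos[of m] by (simp add: qbinomial_def) (simp add: qfact_def)
  have step: "a (Suc k) * qbinomial q (Suc n) (Suc k) =
      a (Suc k) * qbinomial q n (Suc k) - y * q ^ n * (a k * qbinomial q n k)" if "k \<le> n" for k
  proof -
    \<comment> \<open>The exponents agree because (k + 1 choose 2) = (k choose 2) + k. So the second
      half of the Pascal rule reproduces the sum for n with the factor - y * q^n, the new factor of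
      the product.\<close>
    have "q ^ (Suc k choose 2) * q ^ (n - k) = q ^ n * q ^ (k choose 2)"
      using that by (simp add: numeral_2_eq_2 power_add[symmetric] add.commute)
    then have "a (Suc k) * q ^ (n - k) = - (y * q ^ n * a k)"
      unfolding a_def by (simp add: mult_ac)
    then have "a (Suc k) * q ^ (n - k) * qbinomial q n k = - (y * q ^ n * a k) * qbinomial q n k"
      by (rule arg_cong)
    then show ?thesis by (simp add: qbinomial_Suc_Suc distrib_left mult.assoc)
  qed
  have "(\<Sum>k\<le>Suc n. a k * qbinomial q (Suc n) k) = a 0 + (\<Sum>k\<le>n. a (Suc k) * qbinomial q (Suc n) (Suc k))"
    by (subst sum.atMost_Suc_shift) (simp add: a0)
  also have "\<dots> = a 0 + (\<Sum>k\<le>n. a (Suc k) * qbinomial q n (Suc k) - y * q ^ n * (a k * qbinomial q n k))"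
    using step by simp
  also have "\<dots> = (a 0 + (\<Sum>k\<le>n. a (Suc k) * qbinomial q n (Suc k))) - y * q ^ n * (\<Sum>k\<le>n. a k * qbinomial q n k)"
    by (simp add: sum_subtractf sum_distrib_left)
  also have "a 0 + (\<Sum>k\<le>n. a (Suc k) * qbinomial q n (Suc k)) = (\<Sum>k\<le>Suc n. a k * qbinomial q n k)"
    by (subst sum.atMost_Suc_shift) (simp add: a0)
  also have "\<dots> = (\<Sum>k\<le>n. a k * qbinomial q n k)"
    by (simp add: qbinomial_def)
  also have "(\<Sum>k\<le>n. a k * qbinomial q n k) - y * q ^ n * (\<Sum>k\<le>n. a k * qbinomial q n k) = (\<Prod>i<Suc n. 1 - y * q ^ i)"
    using Suc.IH by (simp add: a_def algebra_simps)
  finally show ?case by (simp add: a_def)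
qed

section \<open>Infinite Pochhammer products: limits and bounds\<close>

lemma qpoch_inf_LIMSEQ: "(\<lambda>n. \<Prod>i<n. 1 - c * q ^ i) \<longlonglongrightarrow> qpoch_inf c q"
proof -
  have "(\<lambda>n. \<Prod>i\<le>n. 1 - c * q ^ i) \<longlonglongrightarrow> qpoch_inf c q"
    unfolding qpoch_inf_def
    by (rule convergent_prod_LIMSEQ) (rule convergent_prod_qpoch_inf[OF q01])
  then show ?thesis
    by (subst filterlim_sequentially_Suc[symmetric]) (simp add: lessThan_Suc_atMost del: prod.lessThan_Suc)
qed

lemma qfact_LIMSEQ: "qfact q \<longlonglongrightarrow> qpoch_inf q q"
  unfolding qfact_def[abs_def] by (rule qpoch_inf_LIMSEQ)

lemma qpoch_inf_pos:
  assumes "c < 1"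
  shows "0 < qpoch_inf c q"
proof -
  have f: "0 < 1 - c * q ^ i" for i
  proof (cases "0 \<le> c")
    case True
    then have "c * q ^ i \<le> c" using q01 by (simp add: mult_left_le power_le_one)
    then show ?thesis using assms by linarith
  next
    case False
    then have "c * q ^ i \<le> 0" using q01 by (simp add: mult_le_0_iff)
    then show ?thesis by linarith
  qed
  show ?thesis unfolding qpoch_inf_def
    by (rule less_0_prodinf) (use f convergent_prod_qpoch_inf[OF q01] in \<open>auto simp: less_le_not_le\<close>)
qed

text \<open>The partial products decrease to their limit. With \<open>qfact_le_1\<close> this bounds
  all Gaussian binomials by 1 / (q; q)^2, which supplies the dominating function for the triple
  product.\<close>

lemma qfact_ge: "qpoch_inf q q \<le> qfact q n"
proof (rule decseq_ge[OF _ qfact_LIMSEQ])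
  have "qfact q (Suc n) \<le> qfact q n" for n
    using q01 qfact_pos[of n] by (simp add: qfact_Suc mult_left_le)
  then show "decseq (qfact q)" by (rule decseq_SucI)
qed

lemma qfact_le_1: "qfact q n \<le> 1"
  unfolding qfact_def using q01
  by (intro prod_le_1) (auto simp: mult_le_one power_le_one)

text \<open>Weierstrass' product inequality, with the geometric series for the sum of the c * q^i.
  It quantifies how close a product with small c is to 1.\<close>

lemma qpoch_inf_bounds:
  assumes "0 \<le> c" "c \<le> 1"
  shows "1 - c / (1 - q) \<le> qpoch_inf c q" "qpoch_inf c q \<le> 1"
proof -
  have b: "0 \<le> c * q ^ i \<and> c * q ^ i \<le> 1" for i
    using assms q01 by (simp add: mult_le_one power_le_one)
  have "1 - c / (1 - q) \<le> (\<Prod>i<n. 1 - c * q ^ i)" for n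
  proof -
    have "(\<Sum>i<n. q ^ i) \<le> (\<Sum>i. q ^ i)"
      using q01 by (intro sum_le_suminf) (auto intro: summable_geometric)
    then have "c * (\<Sum>i<n. q ^ i) \<le> c * (1 / (1 - q))"
      using assms q01 by (intro mult_left_mono) (auto simp: suminf_geometric)
    then have "1 - c / (1 - q) \<le> 1 - (\<Sum>i<n. c * q ^ i)"
      by (simp add: sum_distrib_left)
    also have "\<dots> \<le> (\<Prod>i<n. 1 - c * q ^ i)"
      using b by (intro Weierstrass_prod_ineq) auto
    finally show ?thesis .
  qed
  then show "1 - c / (1 - q) \<le> qpoch_inf c q"
    by (intro LIMSEQ_le_const[OF qpoch_inf_LIMSEQ]) auto
  have "(\<Prod>i<n. 1 - c * q ^ i) \<le> 1" for n
    using b by (intro prod_le_1) auto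
  then show "qpoch_inf c q \<le> 1"
    by (intro LIMSEQ_le_const2[OF qpoch_inf_LIMSEQ]) auto
qed

end

text \<open>For q = exp (- 2 * pi / t) the summand is (-1)^k * q^((k + m)^2 / 2): the bilateral
  series of the triple product after completing the square. The natural exponent \<open>nat\<close>
  of |k| merely carries the parity of k.\<close>

definition theta :: "real \<Rightarrow> real \<Rightarrow> real" where
  "theta t m = (\<Sum>\<^sub>ak::int\<in>UNIV. (- 1) ^ nat \<bar>k\<bar> * exp (- (pi / t) * (of_int k + m)\<^sup>2))"

lemma prod_lessThan_add:
  fixes f :: "nat \<Rightarrow> 'a::comm_monoid_mult"
  shows "(\<Prod>i<m + n. f i) = (\<Prod>i<m. f i) * (\<Prod>i<n. f (m + i))"
  by (induction n) (auto simp: mult_ac)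

text \<open>The q-binomial theorem with 2 * N factors, started at y = q^(1/2 + m - N). The upper N
  factors form the first product. From each of the lower N a monomial is pulled out, leaving the
  second product; A collects these monomials and cancels in the end.\<close>

lemma finite_triple_product:
  fixes q m :: real
  assumes q01: "0 < q" "q < 1"
  shows "(\<Prod>i<N. 1 - q powr (1/2 + m) * q ^ i) * (\<Prod>i<N. 1 - q powr (1/2 - m) * q ^ i) =
    (\<Sum>j=-int N..int N. (- 1) ^ nat \<bar>j\<bar> * q powr ((of_int j)\<^sup>2 / 2 + m * of_int j) * qbinomial q (2 * N) (nat (int N + j)))"
proof -
  define y where "y = q powr (1/2 + m - real N)"
  define A where "A = (- 1) ^ N * q powr (m * real N - (real N)\<^sup>2 / 2)"
  have A: "A = (\<Prod>i<N. - (q powr (m - 1/2 - real i)))"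
    unfolding A_def
  proof (induction N)
    case (Suc N)
    have "m * real (Suc N) - (real (Suc N))\<^sup>2 / 2 = (m * real N - (real N)\<^sup>2 / 2) + (m - 1/2 - real N)"
      by (simp add: power2_eq_square field_simps)
    then have "q powr (m * real (Suc N) - (real (Suc N))\<^sup>2 / 2) =
        q powr (m * real N - (real N)\<^sup>2 / 2) * q powr (m - 1/2 - real N)"
      by (simp only: powr_add)
    then show ?case by (simp add: Suc[symmetric])
  qed (use q01 in simp)
  have pq: "q powr x * q ^ i = q powr (x + real i)" for x i
    using q01 by (simp add: powr_add powr_realpow)
  have "(\<Prod>i<2 * N. 1 - y * q ^ i) = (\<Prod>i<N. 1 - y * q ^ i) * (\<Prod>i<N. 1 - y * q ^ (N + i))"
    by (simp only: mult_2 prod_lessThan_add)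
  also have "(\<Prod>i<N. 1 - y * q ^ (N + i)) = (\<Prod>i<N. 1 - q powr (1/2 + m) * q ^ i)"
    unfolding y_def pq by (intro prod.cong refl) (simp add: algebra_simps)
  \<comment> \<open>Reversing the order gives the i-th factor the exponent m - 1/2 - i, the negative
    of the exponent 1/2 - m + i wanted in the second product.\<close>
  also have "(\<Prod>i<N. 1 - y * q ^ i) = (\<Prod>i<N. 1 - y * q ^ (N - Suc i))"
    by (rule prod.nat_diff_reindex[symmetric])
  also have "\<dots> = (\<Prod>i<N. - (q powr (m - 1/2 - real i)) * (1 - q powr (1/2 - m) * q ^ i))"
  proof (intro prod.cong refl)
    fix i assume "i \<in> {..<N}"
    then have "y * q ^ (N - Suc i) = q powr (m - 1/2 - real i)"
      unfolding y_def pq by (simp add: of_nat_diff algebra_simps)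
    moreover have "q powr (m - 1/2 - real i) * (q powr (1/2 - m) * q ^ i) = 1"
      using q01 unfolding pq by (simp add: powr_add[symmetric])
    ultimately show "1 - y * q ^ (N - Suc i) = - (q powr (m - 1/2 - real i)) * (1 - q powr (1/2 - m) * q ^ i)"
      by (simp add: algebra_simps)
  qed
  also have "\<dots> = A * (\<Prod>i<N. 1 - q powr (1/2 - m) * q ^ i)"
    by (simp only: A prod.distrib)
  finally have L: "(\<Prod>i<2 * N. 1 - y * q ^ i) =
     A * ((\<Prod>i<N. 1 - q powr (1/2 + m) * q ^ i) * (\<Prod>i<N. 1 - q powr (1/2 - m) * q ^ i))"
    by (simp add: mult_ac)
  have "(\<Prod>i<2 * N. 1 - y * q ^ i) = (\<Sum>k\<le>2 * N. (- 1) ^ k * q ^ (k choose 2) * y ^ k * qbinomial q (2 * N) k)"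
    by (rule qbinomial_theorem[OF q01])
  also have "\<dots> = (\<Sum>j=-int N..int N. A * ((- 1) ^ nat \<bar>j\<bar> * q powr ((of_int j)\<^sup>2 / 2 + m * of_int j) * qbinomial q (2 * N) (nat (int N + j))))"
  proof (rule sum.reindex_bij_witness[where i = "\<lambda>j. nat (int N + j)" and j = "\<lambda>k. int k - int N"])
    fix k assume k: "k \<in> {..2 * N}"
    define j where "j = int k - int N"
    have rk: "real k = real N + of_int j" by (simp add: j_def)
    have "real (k choose 2) = real k * (real k - 1) / 2"
      by (cases k) (simp_all add: choose_two real_of_nat_div algebra_simps)
    then have "q ^ (k choose 2) = q powr (real k * (real k - 1) / 2)"
      using q01 by (metis powr_realpow)
    moreover have "y ^ k = q powr (real k * (1/2 + m - real N))"
      unfolding y_def using q01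
      by (subst powr_realpow[symmetric]) (simp_all add: powr_powr mult.commute)
    ultimately have 1: "q ^ (k choose 2) * y ^ k = q powr ((real N + of_int j) * (real N + of_int j - 1) / 2 + (real N + of_int j) * (1/2 + m - real N))"
      by (simp only: powr_add rk)
    \<comment> \<open>With the index recentred as k = N + j, the part of the exponent free of j is
      exactly that of A.\<close>
    have "(real N + of_int j) * (real N + of_int j - 1) / 2 + (real N + of_int j) * (1/2 + m - real N)
      = (m * real N - (real N)\<^sup>2 / 2) + ((of_int j)\<^sup>2 / 2 + m * of_int j)"
      by (simp add: power2_eq_square field_simps)
    then have 2: "q ^ (k choose 2) * y ^ k = q powr (m * real N - (real N)\<^sup>2 / 2) * q powr ((of_int j)\<^sup>2 / 2 + m * of_int j)"
      unfolding 1 by (simp only: powr_add)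
    have "even k \<longleftrightarrow> (even N \<longleftrightarrow> even (nat \<bar>j\<bar>))" unfolding j_def by (auto simp: even_nat_iff)
    then have 3: "(- 1 :: real) ^ k = (- 1) ^ N * (- 1) ^ nat \<bar>j\<bar>"
      by (simp add: minus_one_power_iff)
    have "(- 1) ^ k * q ^ (k choose 2) * y ^ k = (- 1) ^ k * (q ^ (k choose 2) * y ^ k)" by simp
    also have "\<dots> = A * ((- 1) ^ nat \<bar>j\<bar> * q powr ((of_int j)\<^sup>2 / 2 + m * of_int j))"
      unfolding 2 3 A_def by (simp only: mult_ac)
    finally show "A * ((- 1) ^ nat \<bar>int k - int N\<bar> * q powr ((of_int (int k - int N))\<^sup>2 / 2 + m * of_int (int k - int N)) * qbinomial q (2 * N) (nat (int N + (int k - int N)))) =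
         (- 1) ^ k * q ^ (k choose 2) * y ^ k * qbinomial q (2 * N) k"
      unfolding j_def[symmetric] by (simp add: j_def)
  qed auto
  finally have "A * ((\<Prod>i<N. 1 - q powr (1/2 + m) * q ^ i) * (\<Prod>i<N. 1 - q powr (1/2 - m) * q ^ i)) =
     A * (\<Sum>j=-int N..int N. (- 1) ^ nat \<bar>j\<bar> * q powr ((of_int j)\<^sup>2 / 2 + m * of_int j) * qbinomial q (2 * N) (nat (int N + j)))"
    unfolding L by (simp add: sum_distrib_left)
  moreover have "A \<noteq> 0" using q01 by (simp add: A_def)
  ultimately show ?thesis by simp
qed

lemma infsetsum_if_mem_finite:
  fixes f :: "'a \<Rightarrow> real"
  assumes "finite S"
  shows "(\<Sum>\<^sub>ax\<in>UNIV. if x \<in> S then f x else 0) = (\<Sum>x\<in>S. f x)"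
proof -
  have "(\<Sum>\<^sub>ax\<in>UNIV. if x \<in> S then f x else 0) = infsetsum f S"
    by (rule infsetsum_cong_neutral) auto
  then show ?thesis using assms by simp
qed

text \<open>The limit of \<open>finite_triple_product\<close>: each Gaussian binomial tends to 1 /
  (q; q) and all are uniformly bounded, so the Gaussian weights dominate.\<close>

theorem jacobi_triple_product:
  fixes t m :: real
  assumes t: "0 < t" and q: "q = exp (- 2 * pi / t)"
  shows "qpoch_inf (q powr (1/2 + m)) q * qpoch_inf (q powr (1/2 - m)) q * qpoch_inf q q
    = exp (pi * m\<^sup>2 / t) * theta t m"
proof -
  have q01: "0 < q" "q < 1" using t by (auto simp: q)
  note Ppos = qpoch_inf_pos[OF q01 q01(2)]
  define e where "e j = q powr ((of_int j)\<^sup>2 / 2 + m * of_int j)" for j :: int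
  \<comment> \<open>Extension by zero puts the sums for all N on one index set, as dominated
    convergence requires.\<close>
  define f where "f N j = (if j \<in> {-int N..int N} then
    (- 1) ^ nat \<bar>j\<bar> * e j * qbinomial q (2 * N) (nat (int N + j)) else 0)" for N j
  have e: "e j = exp (pi * m\<^sup>2 / t) * exp (- (pi / t) * (of_int j + m)\<^sup>2)" for j
    using t by (simp add: e_def q powr_def exp_add[symmetric]) (simp add: field_simps power2_eq_square)
  define B where "B = 1 / (qpoch_inf q q)\<^sup>2"
  have qb: "0 \<le> qbinomial q n k \<and> qbinomial q n k \<le> B" for n k
  proof (cases "k \<le> n")
    case True
    have "(qpoch_inf q q)\<^sup>2 \<le> qfact q k * qfact q (n - k)"
      unfolding power2_eq_square
      using qfact_ge[OF q01] Ppos qfact_pos[OF q01] by (intro mult_mono) (auto simp: less_imp_le)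
    then have "qfact q n / (qfact q k * qfact q (n - k)) \<le> 1 / (qpoch_inf q q)\<^sup>2"
      using qfact_le_1[OF q01, of n] Ppos by (intro frac_le) auto
    moreover have "0 \<le> qfact q n / (qfact q k * qfact q (n - k))"
      using qfact_pos[OF q01] by (simp add: less_imp_le)
    ultimately show ?thesis using True by (simp add: qbinomial_def B_def)
  qed (simp add: qbinomial_def B_def)
  have lim: "(\<lambda>N. f N j) \<longlonglongrightarrow> (- 1) ^ nat \<bar>j\<bar> * e j * (1 / qpoch_inf q q)" for j
  proof -
    have 1: "filterlim (\<lambda>N. nat (int N + j)) at_top sequentially"
      by (rule filterlim_at_top_mono[where f = "\<lambda>N. N - nat \<bar>j\<bar>"])
         (auto intro!: filterlim_minus_const_nat_at_top always_eventually)
    have 2: "filterlim (\<lambda>N. nat (int N - j)) at_top sequentially"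
      by (rule filterlim_at_top_mono[where f = "\<lambda>N. N - nat \<bar>j\<bar>"])
         (auto intro!: filterlim_minus_const_nat_at_top always_eventually)
    have 3: "filterlim (\<lambda>N::nat. 2 * N) at_top sequentially"
      by (rule filterlim_at_top_mono[OF filterlim_ident]) auto
    have "(\<lambda>N. qfact q (2 * N) / (qfact q (nat (int N + j)) * qfact q (nat (int N - j))))
      \<longlonglongrightarrow> qpoch_inf q q / (qpoch_inf q q * qpoch_inf q q)"
      using Ppos by (intro tendsto_intros filterlim_compose[OF qfact_LIMSEQ[OF q01]] 1 2 3) auto
    then have "(\<lambda>N. (- 1) ^ nat \<bar>j\<bar> * e j * (qfact q (2 * N) / (qfact q (nat (int N + j)) * qfact q (nat (int N - j)))))
      \<longlonglongrightarrow> (- 1) ^ nat \<bar>j\<bar> * e j * (1 / qpoch_inf q q)"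
      using Ppos by (intro tendsto_mult tendsto_const) simp
    then show ?thesis
    proof (rule Lim_transform_eventually)
      have "\<forall>\<^sub>F N in sequentially. nat \<bar>j\<bar> \<le> N" by (rule eventually_ge_at_top)
      then show "\<forall>\<^sub>F N in sequentially. (- 1) ^ nat \<bar>j\<bar> * e j * (qfact q (2 * N) / (qfact q (nat (int N + j)) * qfact q (nat (int N - j)))) = f N j"
      proof eventually_elim
        case (elim N)
        then have "nat (int N + j) \<le> 2 * N" "2 * N - nat (int N + j) = nat (int N - j)" "j \<in> {-int N..int N}" by auto
        then show ?case by (simp add: f_def qbinomial_def)
      qed
    qed
  qed
  have bound: "\<bar>f N j\<bar> \<le> B * exp (pi * m\<^sup>2 / t) * exp (- (pi / t) * (of_int j + m)\<^sup>2)" for N j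
  proof -
    have "B \<ge> 0" by (simp add: B_def)
    have "\<bar>f N j\<bar> \<le> e j * B"
      unfolding f_def using qb \<open>B \<ge> 0\<close>
      by (auto simp: abs_mult e_def intro!: mult_left_mono)
    then show ?thesis by (simp add: e mult_ac)
  qed
  have "(\<lambda>N. infsetsum (f N) UNIV) \<longlonglongrightarrow> (\<Sum>\<^sub>aj\<in>UNIV. (- 1) ^ nat \<bar>j\<bar> * e j * (1 / qpoch_inf q q))"
  proof (rule infsetsum_dominated_convergence[OF lim bound])
    show "integrable (count_space UNIV) (\<lambda>j::int. B * exp (pi * m\<^sup>2 / t) * exp (- (pi / t) * (of_int j + m)\<^sup>2))"
      using t by (intro integrable_mult_right integrable_gaussian_int) auto
  qed
  also have "(\<Sum>\<^sub>aj\<in>UNIV. (- 1) ^ nat \<bar>j\<bar> * e j * (1 / qpoch_inf q q))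
     = (\<Sum>\<^sub>aj\<in>UNIV. (exp (pi * m\<^sup>2 / t) / qpoch_inf q q) * ((- 1) ^ nat \<bar>j\<bar> * exp (- (pi / t) * (of_int j + m)\<^sup>2)))"
    by (intro infsetsum_cong) (auto simp: e)
  also have "\<dots> = (exp (pi * m\<^sup>2 / t) / qpoch_inf q q) * theta t m"
    unfolding theta_def infsetsum_def by (rule integral_mult_right_zero)
  also have "(\<lambda>N. infsetsum (f N) UNIV) = (\<lambda>N. (\<Prod>i<N. 1 - q powr (1/2 + m) * q ^ i) * (\<Prod>i<N. 1 - q powr (1/2 - m) * q ^ i))"
    unfolding finite_triple_product[OF q01] f_def[abs_def]
    by (simp only: infsetsum_if_mem_finite finite_atLeastAtMost_int e_def)
  finally have "(\<lambda>N. (\<Prod>i<N. 1 - q powr (1/2 + m) * q ^ i) * (\<Prod>i<N. 1 - q powr (1/2 - m) * q ^ i))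
     \<longlonglongrightarrow> (exp (pi * m\<^sup>2 / t) / qpoch_inf q q) * theta t m" .
  moreover have "(\<lambda>N. (\<Prod>i<N. 1 - q powr (1/2 + m) * q ^ i) * (\<Prod>i<N. 1 - q powr (1/2 - m) * q ^ i))
     \<longlonglongrightarrow> qpoch_inf (q powr (1/2 + m)) q * qpoch_inf (q powr (1/2 - m)) q"
    by (intro tendsto_intros qpoch_inf_LIMSEQ q01)
  ultimately have "qpoch_inf (q powr (1/2 + m)) q * qpoch_inf (q powr (1/2 - m)) q = (exp (pi * m\<^sup>2 / t) / qpoch_inf q q) * theta t m"
    by (rule LIMSEQ_unique[rotated])
  then show ?thesis using Ppos by simp
qed

subsection \<open>Asymptotics of binomial coefficients\<close>

text \<open>The probability of exactly M heads in 2 * M fair coin tosses.\<close>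

definition central_weight :: "nat \<Rightarrow> real" where
  "central_weight M = real (2 * M choose M) / 4 ^ M"

text \<open>Dividing by the central coefficient separates the Gaussian profile in r from the scale 1
  / sqrt (pi * M), so that the two limits can be taken independently.\<close>

definition central_ratio :: "nat \<Rightarrow> nat \<Rightarrow> real" where
  "central_ratio M r = real (2 * M choose (M + r)) / real (2 * M choose M)"

lemma central_weight_Suc:
  "central_weight (Suc n) = central_weight n * ((2 * real n + 1) / (2 * real n + 2))"
proof -
  have f: "fact (2 * Suc n) = (2 * real n + 2) * (2 * real n + 1) * (fact (2 * n) :: real)"
    by (simp add: algebra_simps)
  have g: "fact (Suc n) = (real n + 1) * (fact n :: real)"
    by (simp add: algebra_simps)
  have "real (2 * Suc n choose Suc n) = fact (2 * Suc n) / (fact (Suc n) * fact (Suc n))"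
    by (subst binomial_fact) auto
  also have "\<dots> = (2 * real n + 2) * (2 * real n + 1) / (real n + 1)\<^sup>2 * (fact (2 * n) / (fact n * fact n))"
    unfolding f g by (simp add: power2_eq_square)
  also have "fact (2 * n) / (fact n * fact n) = real (2 * n choose n)"
    by (subst binomial_fact) auto
  finally have B: "real (2 * Suc n choose Suc n) =
      (2 * real n + 2) * (2 * real n + 1) / (real n + 1)\<^sup>2 * real (2 * n choose n)" .
  have "(2 * real n + 2) * (2 * real n + 1) / (real n + 1)\<^sup>2 = 4 * ((2 * real n + 1) / (2 * real n + 2))"
    by (simp add: divide_simps power2_eq_square) (simp add: algebra_simps)
  with B have "real (2 * Suc n choose Suc n) = 4 * ((2 * real n + 1) / (2 * real n + 2)) * real (2 * n choose n)"
    by (simp only:)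
  then have "central_weight (Suc n) = 4 * ((2 * real n + 1) / (2 * real n + 2)) * real (2 * n choose n) / (4 * 4 ^ n)"
    unfolding central_weight_def power_Suc by (simp only:)
  also have "\<dots> = real (2 * n choose n) / 4 ^ n * ((2 * real n + 1) / (2 * real n + 2))"
    by (simp only: mult.assoc mult_divide_mult_cancel_left) (simp add: mult.commute)
  finally show ?thesis unfolding central_weight_def .
qed

lemma central_weight_pos: "0 < central_weight n"
  by (simp add: central_weight_def)

text \<open>The new Wallis factor is (2n + 2)^2 / ((2n + 1) * (2n + 3)); the squared ratio of
  consecutive central weights accounts for it up to the telescoping 2n + 1.\<close>

lemma wallis_central_weight:
  "(\<Prod>k=1..n. (4 * real k ^ 2) / (4 * real k ^ 2 - 1)) = 1 / ((central_weight n)\<^sup>2 * (2 * real n + 1))"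
proof (induction n)
  case (Suc n)
  have "4 * (real (Suc n))\<^sup>2 - 1 = (2 * real n + 1) * (2 * real n + 3)"
    by (simp add: power2_eq_square algebra_simps)
  moreover have "4 * (real (Suc n))\<^sup>2 = (2 * real n + 2)\<^sup>2"
    by (simp add: power2_eq_square algebra_simps)
  ultimately have "(\<Prod>k=1..Suc n. (4 * real k ^ 2) / (4 * real k ^ 2 - 1)) =
     1 / ((central_weight n)\<^sup>2 * (2 * real n + 1)) * ((2 * real n + 2)\<^sup>2 / ((2 * real n + 1) * (2 * real n + 3)))"
    using Suc by simp
  also have "\<dots> = 1 / ((central_weight n * ((2 * real n + 1) / (2 * real n + 2)))\<^sup>2 * (2 * real n + 3))"
    by (simp add: power_mult_distrib power_divide power2_eq_square[of "2 * real n + 1"])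
  finally show ?case by (simp add: central_weight_Suc add.commute)
qed (simp add: central_weight_def)

text \<open>The square of the sequence is n / (2n + 1) divided by the Wallis product, hence tends to
  (1/2) / (pi/2).\<close>

lemma central_weight_asymp: "(\<lambda>n. central_weight n * sqrt (real n)) \<longlonglongrightarrow> 1 / sqrt pi"
proof -
  have 1: "(\<lambda>n. 1 / ((central_weight n)\<^sup>2 * (2 * real n + 1))) \<longlonglongrightarrow> pi / 2"
    using wallis unfolding wallis_central_weight .
  have 2: "(\<lambda>n. real n / (2 * real n + 1)) \<longlonglongrightarrow> 1 / 2"
    by real_asymp
  have "(\<lambda>n. (real n / (2 * real n + 1)) / (1 / ((central_weight n)\<^sup>2 * (2 * real n + 1)))) \<longlonglongrightarrow> (1 / 2) / (pi / 2)"
    by (rule tendsto_divide[OF 2 1]) simp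
  also have "(\<lambda>n. (real n / (2 * real n + 1)) / (1 / ((central_weight n)\<^sup>2 * (2 * real n + 1)))) = (\<lambda>n. (central_weight n)\<^sup>2 * real n)"
  proof
    fix n
    have "2 * real n + 1 \<noteq> 0" by linarith
    then show "(real n / (2 * real n + 1)) / (1 / ((central_weight n)\<^sup>2 * (2 * real n + 1))) = (central_weight n)\<^sup>2 * real n"
      by simp
  qed
  finally have "(\<lambda>n. sqrt ((central_weight n)\<^sup>2 * real n)) \<longlonglongrightarrow> sqrt (1 / pi)"
    by (intro tendsto_real_sqrt) simp
  then show ?thesis
    using central_weight_pos by (simp add: real_sqrt_mult real_sqrt_divide less_imp_le)
qed

lemma central_ratio_Suc:
  "central_ratio M (Suc r) = central_ratio M r * ((real M - real r) / (real M + real r + 1))"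
proof -
  have "real (Suc (M + r)) * real (2 * M choose Suc (M + r)) = (real M - real r) * real (2 * M choose (M + r))"
  proof (cases "r \<le> M")
    case True
    have "Suc (M + r) * (2 * M choose Suc (M + r)) = (2 * M - (M + r)) * (2 * M choose (M + r))"
      by (simp only: binomial_absorption binomial_absorb_comp)
    then have "real (Suc (M + r)) * real (2 * M choose Suc (M + r)) = real (2 * M - (M + r)) * real (2 * M choose (M + r))"
      by (metis of_nat_mult)
    then show ?thesis using True by (simp add: of_nat_diff)
  qed (simp add: binomial_eq_0)
  then have "real (2 * M choose (M + Suc r)) = real (2 * M choose (M + r)) * ((real M - real r) / (real M + real r + 1))"
    by (simp add: field_simps)
  then show ?thesis by (simp add: central_ratio_def)
qed

lemma central_ratio_0: "central_ratio M 0 = 1"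
  by (simp add: central_ratio_def)

lemma central_ratio_nonneg: "0 \<le> central_ratio M r"
  by (simp add: central_ratio_def)

lemma central_ratio_eq_0: "M < r \<Longrightarrow> central_ratio M r = 0"
  by (simp add: central_ratio_def binomial_eq_0)

lemma exp_neg_square_step:
  "exp (- (real r)\<^sup>2 / d) * exp (- ((2 * real r + 1) / d)) = exp (- (real (Suc r))\<^sup>2 / d)"
proof -
  have "(real (Suc r))\<^sup>2 = (real r)\<^sup>2 + (2 * real r + 1)"
    by (simp add: power2_eq_square algebra_simps)
  then have "- (real (Suc r))\<^sup>2 / d = - (real r)\<^sup>2 / d + - ((2 * real r + 1) / d)"
    by (simp only: add_divide_distrib minus_add_distrib minus_divide_left)
  then show ?thesis by (simp only: exp_add)
qed

text \<open>The ratio is a product of factors 1 - (2i + 1) / (M + i + 1), each at most exp (- (2i +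
  1) / (M + R)), and the odd numbers 2i + 1 sum to r^2. The free parameter R serves two uses: R = M
  gives a bound for all r, R = r the sharp one needed for the limit.\<close>

lemma central_ratio_upper:
  assumes "r \<le> R" "R \<le> M"
  shows "central_ratio M r \<le> exp (- (real r)\<^sup>2 / (real M + real R))"
  using assms(1)
proof (induction r)
  case (Suc r)
  have *: "(real M - real r) / (real M + real r + 1) = 1 - (2 * real r + 1) / (real M + real r + 1)"
    by (simp add: field_simps)
  have "1 - (2 * real r + 1) / (real M + real r + 1) \<le> 1 - (2 * real r + 1) / (real M + real R)"
    using Suc.prems by (intro diff_left_mono divide_left_mono) auto
  also have "\<dots> \<le> exp (- ((2 * real r + 1) / (real M + real R)))"
    using exp_ge_add_one_self[of "- ((2 * real r + 1) / (real M + real R))"] by simp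
  finally have "(real M - real r) / (real M + real r + 1) \<le> exp (- ((2 * real r + 1) / (real M + real R)))"
    unfolding * .
  then have "central_ratio M (Suc r) \<le> exp (- (real r)\<^sup>2 / (real M + real R)) * exp (- ((2 * real r + 1) / (real M + real R)))"
    unfolding central_ratio_Suc using Suc.prems assms(2) by (intro mult_mono Suc.IH) auto
  also have "\<dots> = exp (- (real (Suc r))\<^sup>2 / (real M + real R))"
    by (rule exp_neg_square_step)
  finally show ?case .
qed (simp add: central_ratio_0)

lemma central_ratio_le_exp:
  assumes "0 < M"
  shows "central_ratio M r \<le> exp (- (real r)\<^sup>2 / (2 * real M))"
proof (cases "r \<le> M")
  case True
  then show ?thesis using central_ratio_upper[of r M M] by simp
qed (simp add: central_ratio_eq_0)

text \<open>The same product with its factors written as 1 / (1 + (2i + 1) / (M - i)), so that 1 + x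
  <= exp x bounds them from below.\<close>

lemma central_ratio_lower:
  assumes "r \<le> R" "R < M"
  shows "exp (- (real r)\<^sup>2 / (real M - real R)) \<le> central_ratio M r"
  using assms(1)
proof (induction r)
  case (Suc r)
  have pos: "0 < real M - real R" "real M - real R \<le> real M - real r" using assms(2) Suc.prems by auto
  have *: "(real M - real r) / (real M + real r + 1) = 1 / (1 + (2 * real r + 1) / (real M - real r))"
    using pos by (simp add: field_simps)
  have "exp (- ((2 * real r + 1) / (real M - real R))) = 1 / exp ((2 * real r + 1) / (real M - real R))"
    by (simp add: exp_minus divide_inverse)
  also have "\<dots> \<le> 1 / (1 + (2 * real r + 1) / (real M - real R))"
    using pos by (intro divide_left_mono exp_ge_add_one_self) (auto simp: add_pos_nonneg)
  also have "\<dots> \<le> 1 / (1 + (2 * real r + 1) / (real M - real r))"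
    using pos by (intro divide_left_mono add_left_mono) (auto simp: add_pos_nonneg)
  finally have "exp (- (real r)\<^sup>2 / (real M - real R)) * exp (- ((2 * real r + 1) / (real M - real R))) \<le> central_ratio M (Suc r)"
    unfolding central_ratio_Suc * using Suc by (intro mult_mono Suc.IH) (auto intro: central_ratio_nonneg)
  moreover have "exp (- (real r)\<^sup>2 / (real M - real R)) * exp (- ((2 * real r + 1) / (real M - real R)))
     = exp (- (real (Suc r))\<^sup>2 / (real M - real R))"
    by (rule exp_neg_square_step)
  ultimately show ?case by simp
qed (simp add: central_ratio_0)

text \<open>A local de Moivre-Laplace limit: since r / M tends to 0, the exponents r^2 / (M - r) and
  r^2 / (M + r) of the two bounds share the limit of r^2 / M.\<close>

lemma central_ratio_tendsto:
  fixes M r :: "nat \<Rightarrow> nat"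
  assumes M: "filterlim M at_top sequentially"
    and rM: "(\<lambda>n. real (r n) / real (M n)) \<longlonglongrightarrow> 0"
    and r2M: "(\<lambda>n. (real (r n))\<^sup>2 / real (M n)) \<longlonglongrightarrow> \<rho>"
  shows "(\<lambda>n. central_ratio (M n) (r n)) \<longlonglongrightarrow> exp (- \<rho>)"
proof -
  have Mpos: "\<forall>\<^sub>F n in sequentially. 0 < M n"
    using eventually_compose_filterlim[OF eventually_gt_at_top[of 0] M] .
  have "\<forall>\<^sub>F n in sequentially. real (r n) / real (M n) < 1"
    using rM by (rule order_tendstoD) simp
  with Mpos have ev: "\<forall>\<^sub>F n in sequentially. 0 < M n \<and> r n < M n"
    by eventually_elim auto
  have "(\<lambda>n. exp (- ((real (r n))\<^sup>2 / real (M n) / (1 - real (r n) / real (M n))))) \<longlonglongrightarrow> exp (- (\<rho> / (1 - 0)))"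
    by (intro tendsto_intros rM r2M) auto
  then have L: "(\<lambda>n. exp (- ((real (r n))\<^sup>2 / real (M n) / (1 - real (r n) / real (M n))))) \<longlonglongrightarrow> exp (- \<rho>)" by simp
  have "(\<lambda>n. exp (- ((real (r n))\<^sup>2 / real (M n) / (1 + real (r n) / real (M n))))) \<longlonglongrightarrow> exp (- (\<rho> / (1 + 0)))"
    by (intro tendsto_intros rM r2M) auto
  then have U: "(\<lambda>n. exp (- ((real (r n))\<^sup>2 / real (M n) / (1 + real (r n) / real (M n))))) \<longlonglongrightarrow> exp (- \<rho>)" by simp
  show ?thesis
  proof (rule tendsto_sandwich[OF _ _ L U])
    show "\<forall>\<^sub>F n in sequentially. exp (- ((real (r n))\<^sup>2 / real (M n) / (1 - real (r n) / real (M n)))) \<le> central_ratio (M n) (r n)"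
      using ev
    proof eventually_elim
      case (elim n)
      then have "1 - real (r n) / real (M n) = (real (M n) - real (r n)) / real (M n)"
        by (simp add: diff_divide_distrib)
      then have e: "(real (r n))\<^sup>2 / real (M n) / (1 - real (r n) / real (M n)) = (real (r n))\<^sup>2 / (real (M n) - real (r n))"
        using elim by simp
      show ?case unfolding e minus_divide_left
        using elim by (intro central_ratio_lower) auto
    qed
    show "\<forall>\<^sub>F n in sequentially. central_ratio (M n) (r n) \<le> exp (- ((real (r n))\<^sup>2 / real (M n) / (1 + real (r n) / real (M n))))"
      using ev
    proof eventually_elim
      case (elim n)
      then have "1 + real (r n) / real (M n) = (real (M n) + real (r n)) / real (M n)"
        by (simp add: add_divide_distrib)
      then have e: "(real (r n))\<^sup>2 / real (M n) / (1 + real (r n) / real (M n)) = (real (r n))\<^sup>2 / (real (M n) + real (r n))"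
        using elim by simp
      show ?case unfolding e minus_divide_left
        using elim by (intro central_ratio_upper) auto
    qed
  qed
qed

subsection \<open>The theta transformation\<close>

text \<open>A geometric sum whose ratio is a 2K-th root of unity, equal to 1 exactly under the
  divisibility condition. The frequency is shifted by K because the sign (-1)^x is absorbed as cis
  (pi * x).\<close>

lemma sum_cis_roots_of_unity:
  fixes \<nu> l :: int
  assumes K: "0 < K"
  shows "(\<Sum>i<2 * K. cis (pi * (of_int l + real i) * (real K + of_int \<nu>) / real K))
    = (if 2 * int K dvd int K + \<nu> then of_nat (2 * K) else 0)"
proof -
  define \<omega> where "\<omega> = cis (pi * (real K + of_int \<nu>) / real K)"
  have "cis (pi * (of_int l + real i) * (real K + of_int \<nu>) / real K) = cis (pi * of_int l * (real K + of_int \<nu>) / real K) * \<omega> ^ i" for i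
    unfolding \<omega>_def Complex.DeMoivre cis_mult
    by (rule arg_cong[of _ _ cis]) (use K in \<open>simp add: field_simps\<close>)
  then have S: "(\<Sum>i<2 * K. cis (pi * (of_int l + real i) * (real K + of_int \<nu>) / real K))
     = cis (pi * of_int l * (real K + of_int \<nu>) / real K) * (\<Sum>i<2 * K. \<omega> ^ i)"
    by (simp add: sum_distrib_left)
  show ?thesis
  proof (cases "2 * int K dvd int K + \<nu>")
    case True
    then obtain s where "int K + \<nu> = 2 * int K * s" by blast
    then have s: "real K + of_int \<nu> = 2 * real K * of_int s"
      by (metis of_int_add of_int_mult of_int_numeral of_int_of_nat_eq)
    have "\<omega> = cis (2 * pi * of_int s)" using K by (simp add: \<omega>_def s mult_ac)
    then have "\<omega> = 1" by (simp only: cis_multiple_2pi Ints_of_int)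
    moreover have "cis (pi * of_int l * (real K + of_int \<nu>) / real K) = cis (2 * pi * of_int (l * s))"
      using K by (simp add: s mult_ac)
    then have "cis (pi * of_int l * (real K + of_int \<nu>) / real K) = 1"
      by (simp only: cis_multiple_2pi Ints_of_int)
    ultimately show ?thesis unfolding S using True by simp
  next
    case False
    have "\<omega> \<noteq> 1"
    proof
      assume "\<omega> = 1"
      then have "cos (pi * (real K + of_int \<nu>) / real K) = 1"
        unfolding \<omega>_def by (metis cis.sel(1) one_complex.sel(1))
      then obtain s :: int where "pi * (real K + of_int \<nu>) / real K = of_int s * 2 * pi"
        using cos_one_2pi_int by blast
      then have "pi * (real K + of_int \<nu>) = pi * (2 * real K * of_int s)"
        using K by (simp add: divide_eq_eq mult_ac)
      then have "real K + of_int \<nu> = 2 * real K * of_int s"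
        by (simp only: mult_cancel_left) simp
      then have "real_of_int (int K + \<nu>) = real_of_int (2 * int K * s)" by simp
      then have "int K + \<nu> = 2 * int K * s" by (simp only: of_int_eq_iff)
      with False show False by simp
    qed
    moreover have "\<omega> ^ (2 * K) = 1"
    proof -
      have "\<omega> ^ (2 * K) = cis (2 * pi * of_int (int K + \<nu>))"
        unfolding \<omega>_def Complex.DeMoivre
        by (rule arg_cong[of _ _ cis]) (use K in \<open>simp add: field_simps\<close>)
      then show ?thesis by (simp only: cis_multiple_2pi Ints_of_int)
    qed
    ultimately have "(\<Sum>i<2 * K. \<omega> ^ i) = 0" by (simp add: geometric_sum)
    then show ?thesis unfolding S using False by simp
  qed
qed

text \<open>The binomial theorem for cis phi + cis (- phi). By symmetry the coefficient is written
  through the distance from the centre, the form in which \<open>central_ratio\<close> measures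
  it.\<close>

lemma cos_power_even_expansion:
  "complex_of_real ((2 * cos \<phi>) ^ (2 * M)) = (\<Sum>\<nu>=-int M..int M. of_nat (2 * M choose (M + nat \<bar>\<nu>\<bar>)) * cis (2 * of_int \<nu> * \<phi>))"
proof -
  have "complex_of_real (2 * cos \<phi>) = cis \<phi> + cis (- \<phi>)"
    by (simp add: complex_eq_iff)
  then have "complex_of_real ((2 * cos \<phi>) ^ (2 * M)) = (cis \<phi> + cis (- \<phi>)) ^ (2 * M)"
    by (simp only: of_real_power)
  also have "\<dots> = (\<Sum>k\<le>2 * M. of_nat (2 * M choose k) * cis \<phi> ^ k * cis (- \<phi>) ^ (2 * M - k))"
    by (rule binomial_ring)
  also have "\<dots> = (\<Sum>\<nu>=-int M..int M. of_nat (2 * M choose (M + nat \<bar>\<nu>\<bar>)) * cis (2 * of_int \<nu> * \<phi>))"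
  proof (rule sum.reindex_bij_witness[where i = "\<lambda>\<nu>. nat (int M + \<nu>)" and j = "\<lambda>k. int k - int M"])
    fix k assume k: "k \<in> {..2 * M}"
    have "(2 * M choose (M + nat \<bar>int k - int M\<bar>)) = (2 * M choose k)"
    proof (cases "k < M")
      case True
      then have "M + nat \<bar>int k - int M\<bar> = 2 * M - k" by auto
      then show ?thesis using k by (metis atMost_iff binomial_symmetric)
    next
      case False
      then have "M + nat \<bar>int k - int M\<bar> = k" by simp
      then show ?thesis by (simp only:)
    qed
    moreover have "cis \<phi> ^ k * cis (- \<phi>) ^ (2 * M - k) = cis (2 * of_int (int k - int M) * \<phi>)"
      using k unfolding Complex.DeMoivre cis_mult
      by (intro arg_cong[of _ _ cis]) (simp add: of_nat_diff algebra_simps)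
    ultimately show "of_nat (2 * M choose (M + nat \<bar>int k - int M\<bar>)) * cis (2 * of_int (int k - int M) * \<phi>) =
         of_nat (2 * M choose k) * cis \<phi> ^ k * cis (- \<phi>) ^ (2 * M - k)"
      by (simp only: mult.assoc)
  qed auto
  finally show ?thesis .
qed

text \<open>The samples cover a full period, so among the frequencies of the cosine power only those
  congruent to K modulo 2K survive: the odd multiples of K. The series on the right is finite, as
  the binomials vanish once K * |2k + 1| exceeds M.\<close>

lemma sum_cos_power_even:
  fixes m :: real and l :: int
  assumes K: "0 < K"
  shows "(\<Sum>i<2 * K. cos (pi * (of_int l + real i)) * (2 * cos (pi * (of_int l + real i + m) / (2 * real K))) ^ (2 * M))
    = 2 * real K * (\<Sum>\<^sub>ak::int\<in>UNIV. real (2 * M choose (M + nat \<bar>int K * (2 * k + 1)\<bar>)) * cos (pi * of_int (2 * k + 1) * m))"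
proof -
  define c where "c \<nu> = complex_of_real (real (2 * M choose (M + nat \<bar>\<nu>\<bar>)))" for \<nu> :: int
  define x where "x i = of_int l + real i" for i
  have sgn: "complex_of_real (cos (pi * x i)) = cis (pi * x i)" for i
  proof -
    have "pi * x i = pi * of_int (l + int i)" by (simp add: x_def)
    then have "sin (pi * x i) = 0" by (metis sin_npi_int mult.commute)
    then show ?thesis by (simp add: complex_eq_iff)
  qed
  have "complex_of_real (\<Sum>i<2 * K. cos (pi * x i) * (2 * cos (pi * (x i + m) / (2 * real K))) ^ (2 * M))
    = (\<Sum>i<2 * K. cis (pi * x i) * (\<Sum>\<nu>=-int M..int M. c \<nu> * cis (2 * of_int \<nu> * (pi * (x i + m) / (2 * real K)))))"
    by (simp only: of_real_sum of_real_mult[of "cos _"] sgn cos_power_even_expansion c_def of_real_of_nat_eq)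
  also have "\<dots> = (\<Sum>\<nu>=-int M..int M. c \<nu> * cis (pi * of_int \<nu> * m / real K) * (\<Sum>i<2 * K. cis (pi * x i * (real K + of_int \<nu>) / real K)))"
    unfolding sum_distrib_left
  proof (subst sum.swap, intro sum.cong refl)
    fix \<nu> i
    have "cis (pi * x i) * cis (2 * of_int \<nu> * (pi * (x i + m) / (2 * real K)))
       = cis (pi * of_int \<nu> * m / real K) * cis (pi * x i * (real K + of_int \<nu>) / real K)"
      unfolding cis_mult by (rule arg_cong[of _ _ cis]) (use K in \<open>simp add: field_simps\<close>)
    then show "cis (pi * x i) * (c \<nu> * cis (2 * of_int \<nu> * (pi * (x i + m) / (2 * real K)))) =
       c \<nu> * cis (pi * of_int \<nu> * m / real K) * cis (pi * x i * (real K + of_int \<nu>) / real K)"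
      by (simp only: mult_ac)
  qed
  also have "\<dots> = (\<Sum>\<nu>=-int M..int M. if 2 * int K dvd int K + \<nu> then of_nat (2 * K) * (c \<nu> * cis (pi * of_int \<nu> * m / real K)) else 0)"
    unfolding x_def sum_cis_roots_of_unity[OF K] by (intro sum.cong refl) simp
  finally have "(\<Sum>i<2 * K. cos (pi * x i) * (2 * cos (pi * (x i + m) / (2 * real K))) ^ (2 * M))
    = Re (\<Sum>\<nu>=-int M..int M. if 2 * int K dvd int K + \<nu> then of_nat (2 * K) * (c \<nu> * cis (pi * of_int \<nu> * m / real K)) else 0)"
    by (metis Re_complex_of_real)
  also have "\<dots> = (\<Sum>\<nu>=-int M..int M. if 2 * int K dvd int K + \<nu> then 2 * real K * (real (2 * M choose (M + nat \<bar>\<nu>\<bar>)) * cos (pi * of_int \<nu> * m / real K)) else 0)"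
    unfolding Re_sum by (intro sum.cong refl) (simp add: c_def)
  also have "\<dots> = (\<Sum>\<nu>\<in>{\<nu>\<in>{-int M..int M}. 2 * int K dvd int K + \<nu>}. 2 * real K * (real (2 * M choose (M + nat \<bar>\<nu>\<bar>)) * cos (pi * of_int \<nu> * m / real K)))"
    by (subst sum.inter_filter) auto
  also have "\<dots> = (\<Sum>k\<in>{k. \<bar>int K * (2 * k + 1)\<bar> \<le> int M}. 2 * real K * (real (2 * M choose (M + nat \<bar>int K * (2 * k + 1)\<bar>)) * cos (pi * of_int (2 * k + 1) * m)))"
  \<comment> \<open>If K + nu = 2 * K * s, then nu = K * (2 * (s - 1) + 1); hence the subtraction of
    1 in the inverse map.\<close>
  proof (rule sum.reindex_bij_witness[where i = "\<lambda>k. int K * (2 * k + 1)" and j = "\<lambda>\<nu>. (int K + \<nu>) div (2 * int K) - 1"])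
    fix \<nu> assume "\<nu> \<in> {\<nu>\<in>{-int M..int M}. 2 * int K dvd int K + \<nu>}"
    then have "2 * int K dvd int K + \<nu>" and n: "\<bar>\<nu>\<bar> \<le> int M" by auto
    then obtain s where s: "int K + \<nu> = 2 * int K * s" by (elim dvdE)
    have d: "(int K + \<nu>) div (2 * int K) = s" unfolding s using K by simp
    have \<nu>: "int K * (2 * (s - 1) + 1) = \<nu>" using s by (simp add: algebra_simps)
    show "int K * (2 * ((int K + \<nu>) div (2 * int K) - 1) + 1) = \<nu>" unfolding d by (rule \<nu>)
    show "(int K + \<nu>) div (2 * int K) - 1 \<in> {k. \<bar>int K * (2 * k + 1)\<bar> \<le> int M}"
      unfolding d using \<nu> n by simp
    have "real_of_int \<nu> = real K * of_int (2 * (s - 1) + 1)" unfolding \<nu>[symmetric] by simp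
    then have "pi * of_int \<nu> * m / real K = pi * of_int (2 * (s - 1) + 1) * m"
      using K by simp
    then show "2 * real K * (real (2 * M choose (M + nat \<bar>int K * (2 * ((int K + \<nu>) div (2 * int K) - 1) + 1)\<bar>)) *
          cos (pi * real_of_int (2 * ((int K + \<nu>) div (2 * int K) - 1) + 1) * m)) =
         2 * real K * (real (2 * M choose (M + nat \<bar>\<nu>\<bar>)) * cos (pi * real_of_int \<nu> * m / real K))"
      unfolding d \<nu> by simp
  next
    fix k assume k: "k \<in> {k. \<bar>int K * (2 * k + 1)\<bar> \<le> int M}"
    have e: "int K + int K * (2 * k + 1) = 2 * int K * (k + 1)" by (simp add: algebra_simps)
    show "(int K + int K * (2 * k + 1)) div (2 * int K) - 1 = k"
      unfolding e using K by simp
    show "int K * (2 * k + 1) \<in> {\<nu>\<in>{-int M..int M}. 2 * int K dvd int K + \<nu>}"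
      using k unfolding mem_Collect_eq e by (simp add: abs_le_iff)
  qed
  also have "\<dots> = 2 * real K * (\<Sum>k\<in>{k. \<bar>int K * (2 * k + 1)\<bar> \<le> int M}. real (2 * M choose (M + nat \<bar>int K * (2 * k + 1)\<bar>)) * cos (pi * of_int (2 * k + 1) * m))"
    by (simp only: sum_distrib_left)
  also have "(\<Sum>k\<in>{k. \<bar>int K * (2 * k + 1)\<bar> \<le> int M}. real (2 * M choose (M + nat \<bar>int K * (2 * k + 1)\<bar>)) * cos (pi * of_int (2 * k + 1) * m))
     = (\<Sum>\<^sub>ak::int\<in>{k. \<bar>int K * (2 * k + 1)\<bar> \<le> int M}. real (2 * M choose (M + nat \<bar>int K * (2 * k + 1)\<bar>)) * cos (pi * of_int (2 * k + 1) * m))"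
  proof (rule infsetsum_finite[symmetric])
    have "\<bar>k\<bar> \<le> int M" if "\<bar>int K * (2 * k + 1)\<bar> \<le> int M" for k
    proof -
      have "\<bar>k\<bar> \<le> 1 * \<bar>2 * k + 1\<bar>" by arith
      also have "\<dots> \<le> int K * \<bar>2 * k + 1\<bar>" using K by (intro mult_right_mono) auto
      finally show ?thesis using that by (simp add: abs_mult)
    qed
    then have "{k. \<bar>int K * (2 * k + 1)\<bar> \<le> int M} \<subseteq> {-int M..int M}"
      by (metis (mono_tags, lifting) abs_le_D1 abs_le_D2 atLeastAtMost_iff mem_Collect_eq minus_le_iff subsetI)
    then show "finite {k. \<bar>int K * (2 * k + 1)\<bar> \<le> int M}" by (rule finite_subset) simp
  qed
  also have "\<dots> = (\<Sum>\<^sub>ak::int\<in>UNIV. real (2 * M choose (M + nat \<bar>int K * (2 * k + 1)\<bar>)) * cos (pi * of_int (2 * k + 1) * m))"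
    by (rule infsetsum_cong_neutral) (auto simp: binomial_eq_0)
  finally show ?thesis by (simp only: x_def)
qed

section \<open>Bounds and limits for powers of the cosine\<close>

text \<open>Jordan's inequality: the sine is concave on [0, pi/2] and so lies above its chord. This
  later dominates the high cosine powers over the whole sampling window.\<close>

lemma cos_squared_le:
  assumes "\<bar>y\<bar> \<le> pi / 2"
  shows "(cos y)\<^sup>2 \<le> 1 - (2 * y / pi)\<^sup>2"
proof -
  have jordan: "2 * z / pi \<le> sin z" if z: "0 \<le> z" "z \<le> pi / 2" for z
  proof -
    have cvx: "convex_on {0..pi/2} (\<lambda>x. - sin x)"
    proof (rule f''_ge0_imp_convex)
      show "((\<lambda>x. - sin x) has_real_derivative - cos x) (at x)" for x :: real
        by (auto intro!: derivative_eq_intros)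
      show "((\<lambda>x. - cos x) has_real_derivative sin x) (at x)" for x :: real
        by (auto intro!: derivative_eq_intros)
      show "0 \<le> sin x" if "x \<in> {0..pi/2}" for x
        using that by (intro sin_ge_zero) auto
    qed simp
    have "2 * z / pi \<le> 1" using z by (simp add: field_simps)
    then have "- sin ((1 - 2 * z / pi) *\<^sub>R 0 + (2 * z / pi) *\<^sub>R (pi / 2)) \<le> (1 - 2 * z / pi) * - sin 0 + (2 * z / pi) * - sin (pi / 2)"
      using z by (intro convex_onD[OF cvx]) auto
    then show ?thesis by simp
  qed
  have "\<bar>2 * y / pi\<bar> \<le> \<bar>sin y\<bar>"
  proof (cases "0 \<le> y")
    case True
    then show ?thesis using jordan[of y] assms by (simp add: abs_le_iff)
  next
    case False
    then show ?thesis using jordan[of "- y"] assms by (simp add: abs_le_iff)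
  qed
  then have "(2 * y / pi)\<^sup>2 \<le> (sin y)\<^sup>2" by (simp only: abs_le_square_iff)
  then show ?thesis using sin_cos_squared_add[of y] by linarith
qed

text \<open>The logarithm of the power is 2 * M * ln (cos y), and ln (cos y) / y^2 tends to -1/2 in
  the punctured limit at 0; the constant case y = 0 is left to the caller.\<close>

lemma cos_power_tendsto:
  fixes M :: "nat \<Rightarrow> nat" and y :: "nat \<Rightarrow> real"
  assumes y0: "y \<longlonglongrightarrow> 0" and My: "(\<lambda>n. real (M n) * (y n)\<^sup>2) \<longlonglongrightarrow> \<rho>"
    and nz: "\<And>n. y n \<noteq> 0"
  shows "(\<lambda>n. cos (y n) ^ (2 * M n)) \<longlonglongrightarrow> exp (- \<rho>)"
proof -
  have "((\<lambda>y::real. ln (cos y) / y\<^sup>2) \<longlongrightarrow> - 1 / 2) (at 0)"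
    by real_asymp
  moreover have "filterlim y (at 0) sequentially"
    using y0 nz by (simp add: filterlim_at)
  ultimately have lim: "(\<lambda>n. ln (cos (y n)) / (y n)\<^sup>2) \<longlonglongrightarrow> - 1 / 2"
    by (rule filterlim_compose)
  have "(\<lambda>n. exp (2 * (ln (cos (y n)) / (y n)\<^sup>2) * (real (M n) * (y n)\<^sup>2))) \<longlonglongrightarrow> exp (2 * (- 1 / 2) * \<rho>)"
    by (intro tendsto_exp tendsto_mult tendsto_const lim My)
  then have "(\<lambda>n. exp (2 * (ln (cos (y n)) / (y n)\<^sup>2) * (real (M n) * (y n)\<^sup>2))) \<longlonglongrightarrow> exp (- \<rho>)"
    by simp
  then show ?thesis
  proof (rule Lim_transform_eventually)
    have "(\<lambda>n. cos (y n)) \<longlonglongrightarrow> cos 0" by (intro tendsto_intros y0)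
    then have "\<forall>\<^sub>F n in sequentially. 0 < cos (y n)" by (rule order_tendstoD) simp
    then show "\<forall>\<^sub>F n in sequentially. exp (2 * (ln (cos (y n)) / (y n)\<^sup>2) * (real (M n) * (y n)\<^sup>2)) = cos (y n) ^ (2 * M n)"
    proof eventually_elim
      case (elim n)
      have "cos (y n) ^ (2 * M n) = exp (real (2 * M n) * ln (cos (y n)))"
        using elim by (simp only: exp_of_nat_mult exp_ln)
      also have "real (2 * M n) * ln (cos (y n)) = 2 * (ln (cos (y n)) / (y n)\<^sup>2) * (real (M n) * (y n)\<^sup>2)"
        using nz[of n] by simp
      finally show ?case ..
    qed
  qed
qed

text \<open>
  Polya's argument: \<open>cos\<close> to the power \<open>2 * M\<close>, sampled at \<open>2 * K\<close> equidistant points, sums to a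
  sparse sum of binomial coefficients; with \<open>M\<close> of order \<open>4 * K\<^sup>2 / (pi * t)\<close> both sides
  become Gaussian sums.
\<close>

theorem theta_transformation:
  fixes t m :: real
  assumes t: "0 < t"
  shows "theta t m = sqrt t * (\<Sum>\<^sub>ak::int\<in>UNIV. exp (- (pi * t) * (of_int k + 1/2)\<^sup>2) * cos (pi * of_int (2 * k + 1) * m))"
proof -
  define K where "K n = Suc n" for n
  \<comment> \<open>This choice makes M * (pi * s / (2 * K))^2 tend to pi * s^2 / t and (K * (2k +
    1))^2 / M tend to pi * t * (k + 1/2)^2, the exponents of the two sides.\<close>
  define M where "M n = nat \<lceil>4 * (real (K n))\<^sup>2 / (pi * t)\<rceil>" for n
  \<comment> \<open>The window of 2K integers starts here so that |x + m| <= K on it. The argument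
    of the cosine then stays in [- pi/2, pi/2], where \<open>cos_squared_le\<close> applies.\<close>
  define l where "l n = \<lceil>- m\<rceil> - int (K n)" for n
  define W where "W n = {l n..<l n + 2 * int (K n)}" for n
  \<comment> \<open>As K >= 1, rounding up in M costs at most K^2, whence M <= D * K^2.\<close>
  define D where "D = 4 / (pi * t) + 1"
  define f where "f n x = (if x \<in> W n then (- 1) ^ nat \<bar>x\<bar> * cos (pi * (of_int x + m) / (2 * real (K n))) ^ (2 * M n) else 0)" for n x
  define g where "g n k = central_ratio (M n) (nat \<bar>int (K n) * (2 * k + 1)\<bar>) * cos (pi * of_int (2 * k + 1) * m)" for n k
  have D: "0 < D" using t by (simp add: D_def add_pos_pos)
  have Kpos: "0 < K n" "1 \<le> (real (K n))\<^sup>2" for n by (simp_all add: K_def)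
  have Kinf: "filterlim (\<lambda>n. real (K n)) at_top sequentially" unfolding K_def by real_asymp
  have Mlow: "4 * (real (K n))\<^sup>2 / (pi * t) \<le> real (M n)" for n
    unfolding M_def by (rule real_nat_ceiling_ge)
  have Mup': "real (M n) \<le> 4 * (real (K n))\<^sup>2 / (pi * t) + 1" for n
  proof -
    have "0 \<le> 4 * (real (K n))\<^sup>2 / (pi * t)" using t by simp
    then show ?thesis unfolding M_def by linarith
  qed
  have Mup: "real (M n) \<le> D * (real (K n))\<^sup>2" for n
    using Mup'[of n] Kpos(2)[of n] by (simp add: D_def algebra_simps)
  have Mpos: "0 < M n" for n
  proof -
    have "0 < 4 * (real (K n))\<^sup>2 / (pi * t)" using t Kpos(1)[of n] by simp
    then show ?thesis using Mlow[of n] by linarith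
  qed
  have MK: "(\<lambda>n. real (M n) / (real (K n))\<^sup>2) \<longlonglongrightarrow> 4 / (pi * t)"
  proof (rule tendsto_sandwich[where f = "\<lambda>_. 4 / (pi * t)" and h = "\<lambda>n. 4 / (pi * t) + 1 / (real (K n))\<^sup>2"])
    have "(\<lambda>n. 1 / (real (K n))\<^sup>2) \<longlonglongrightarrow> 0" unfolding K_def by real_asymp
    then have "(\<lambda>n. 4 / (pi * t) + 1 / (real (K n))\<^sup>2) \<longlonglongrightarrow> 4 / (pi * t) + 0"
      by (intro tendsto_intros)
    then show "(\<lambda>n. 4 / (pi * t) + 1 / (real (K n))\<^sup>2) \<longlonglongrightarrow> 4 / (pi * t)" by simp
    show "\<forall>\<^sub>F n in sequentially. 4 / (pi * t) \<le> real (M n) / (real (K n))\<^sup>2"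
      using Mlow Kpos by (intro always_eventually allI) (simp add: pos_le_divide_eq)
    have "real (M n) / (real (K n))\<^sup>2 \<le> 4 / (pi * t) + 1 / (real (K n))\<^sup>2" for n
    proof -
      have "real (M n) / (real (K n))\<^sup>2 \<le> (4 * (real (K n))\<^sup>2 / (pi * t) + 1) / (real (K n))\<^sup>2"
        using Mup' by (intro divide_right_mono) auto
      also have "\<dots> = 4 / (pi * t) + 1 / (real (K n))\<^sup>2"
        using Kpos(1)[of n] by (simp add: add_divide_distrib)
      finally show ?thesis .
    qed
    then show "\<forall>\<^sub>F n in sequentially. real (M n) / (real (K n))\<^sup>2 \<le> 4 / (pi * t) + 1 / (real (K n))\<^sup>2"
      by (intro always_eventually allI)
  qed simp
  have Minf: "filterlim M at_top sequentially"
  proof -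
    have "filterlim (\<lambda>n. 4 * (real (K n))\<^sup>2 / (pi * t)) at_top sequentially"
      unfolding K_def using t by real_asymp
    then have "filterlim (\<lambda>n. real (M n)) at_top sequentially"
      by (rule filterlim_at_top_mono) (use Mlow in auto)
    then have "\<forall>\<^sub>F n in sequentially. real Z \<le> real (M n)" for Z
      unfolding filterlim_at_top by blast
    then show ?thesis unfolding filterlim_at_top by simp
  qed

  have flim: "(\<lambda>n. f n x) \<longlonglongrightarrow> (- 1) ^ nat \<bar>x\<bar> * exp (- (pi / t) * (of_int x + m)\<^sup>2)" for x
  proof -
    define s where "s = of_int x + m"
    have "(\<lambda>n. cos (pi * s / (2 * real (K n))) ^ (2 * M n)) \<longlonglongrightarrow> exp (- (pi / t * s\<^sup>2))"
    proof (cases "s = 0")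
      case False
      show ?thesis
      proof (rule cos_power_tendsto)
        show "(\<lambda>n. pi * s / (2 * real (K n))) \<longlonglongrightarrow> 0" unfolding K_def by real_asymp
        have "(\<lambda>n. real (M n) / (real (K n))\<^sup>2 * (pi\<^sup>2 * s\<^sup>2 / 4)) \<longlonglongrightarrow> 4 / (pi * t) * (pi\<^sup>2 * s\<^sup>2 / 4)"
          by (intro tendsto_intros MK)
        moreover have "4 / (pi * t) * (pi\<^sup>2 * s\<^sup>2 / 4) = pi / t * s\<^sup>2"
          by (simp add: power2_eq_square)
        moreover have "real (M n) / (real (K n))\<^sup>2 * (pi\<^sup>2 * s\<^sup>2 / 4) = real (M n) * (pi * s / (2 * real (K n)))\<^sup>2" for n
          by (simp add: power_divide power_mult_distrib)
        ultimately show "(\<lambda>n. real (M n) * (pi * s / (2 * real (K n)))\<^sup>2) \<longlonglongrightarrow> pi / t * s\<^sup>2"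
          by simp
        show "pi * s / (2 * real (K n)) \<noteq> 0" for n using False Kpos(1)[of n] by simp
      qed
    qed simp
    then have "(\<lambda>n. (- 1) ^ nat \<bar>x\<bar> * cos (pi * s / (2 * real (K n))) ^ (2 * M n)) \<longlonglongrightarrow> (- 1) ^ nat \<bar>x\<bar> * exp (- (pi / t * s\<^sup>2))"
      by (intro tendsto_intros)
    then have "(\<lambda>n. f n x) \<longlonglongrightarrow> (- 1) ^ nat \<bar>x\<bar> * exp (- (pi / t * s\<^sup>2))"
    proof (rule Lim_transform_eventually)
      have "\<forall>\<^sub>F n in sequentially. nat (\<bar>x\<bar> + \<bar>\<lceil>- m\<rceil>\<bar>) \<le> n" by (rule eventually_ge_at_top)
      then show "\<forall>\<^sub>F n in sequentially. (- 1) ^ nat \<bar>x\<bar> * cos (pi * s / (2 * real (K n))) ^ (2 * M n) = f n x"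
      proof eventually_elim
        case (elim n)
        then have "x \<in> W n" by (auto simp: W_def l_def K_def)
        then show ?case by (simp add: f_def s_def)
      qed
    qed
    then show ?thesis by (simp add: s_def)
  qed
  \<comment> \<open>The dominating Gaussian has the rate 4 / (pi * t), smaller than the limiting
    rate pi / t, but holds uniformly in n.\<close>
  have fbound: "\<bar>f n x\<bar> \<le> exp (- (4 / (pi * t)) * (of_int x + m)\<^sup>2)" for n x
  proof (cases "x \<in> W n")
    case True
    define s where "s = of_int x + m"
    define y where "y = pi * s / (2 * real (K n))"
    have "\<lceil>- m\<rceil> - int (K n) \<le> x" "x \<le> \<lceil>- m\<rceil> + int (K n) - 1" using True by (auto simp: W_def l_def)
    then have "real_of_int \<lceil>- m\<rceil> - real (K n) \<le> of_int x" "of_int x \<le> real_of_int \<lceil>- m\<rceil> + real (K n) - 1"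
      by linarith+
    then have "\<bar>s\<bar> \<le> real (K n)" unfolding s_def by linarith
    then have "pi * \<bar>s\<bar> \<le> pi * real (K n)" by (intro mult_left_mono) auto
    then have "\<bar>y\<bar> \<le> pi / 2"
      using Kpos(1)[of n] by (simp add: y_def abs_mult pos_divide_le_eq)
    then have "(cos y)\<^sup>2 \<le> 1 - (2 * y / pi)\<^sup>2" by (rule cos_squared_le)
    also have "2 * y / pi = s / real (K n)" by (simp add: y_def)
    also have "1 - (s / real (K n))\<^sup>2 \<le> exp (- (s / real (K n))\<^sup>2)"
      using exp_ge_add_one_self[of "- (s / real (K n))\<^sup>2"] by simp
    finally have "((cos y)\<^sup>2) ^ M n \<le> exp (- (s / real (K n))\<^sup>2) ^ M n"
      by (intro power_mono) auto
    also have "\<dots> = exp (- ((real (M n) / (real (K n))\<^sup>2) * s\<^sup>2))"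
      by (simp add: exp_of_nat_mult[symmetric] power_divide)
    also have "\<dots> \<le> exp (- (4 / (pi * t) * s\<^sup>2))"
    proof -
      have "4 / (pi * t) \<le> real (M n) / (real (K n))\<^sup>2"
        using Mlow[of n] Kpos(1)[of n] by (simp add: pos_le_divide_eq)
      then have "4 / (pi * t) * s\<^sup>2 \<le> real (M n) / (real (K n))\<^sup>2 * s\<^sup>2"
        by (intro mult_right_mono) auto
      then show ?thesis by simp
    qed
    finally have "cos y ^ (2 * M n) \<le> exp (- (4 / (pi * t) * s\<^sup>2))"
      by (simp only: power_mult)
    moreover have "\<bar>f n x\<bar> = cos y ^ (2 * M n)"
      using True by (simp add: f_def y_def s_def abs_mult)
    ultimately show ?thesis by (simp add: s_def)
  qed (simp add: f_def)
  have "(\<lambda>n. infsetsum (f n) UNIV) \<longlonglongrightarrow> (\<Sum>\<^sub>ax\<in>UNIV. (- 1) ^ nat \<bar>x\<bar> * exp (- (pi / t) * (of_int x + m)\<^sup>2))"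
    by (rule infsetsum_dominated_convergence[OF flim fbound integrable_gaussian_int]) (use t in simp)
  then have flim': "(\<lambda>n. infsetsum (f n) UNIV) \<longlonglongrightarrow> theta t m"
    by (simp only: theta_def)

  have glim: "(\<lambda>n. g n k) \<longlonglongrightarrow> exp (- (pi * t) * (of_int k + 1/2)\<^sup>2) * cos (pi * of_int (2 * k + 1) * m)" for k
  proof -
    define c where "c = \<bar>real_of_int (2 * k + 1)\<bar>"
    have r: "real (nat \<bar>int (K n) * (2 * k + 1)\<bar>) = real (K n) * c" for n
      by (simp add: c_def abs_mult)
    have "(\<lambda>n. (1 / real (K n)) * (c / (real (M n) / (real (K n))\<^sup>2))) \<longlonglongrightarrow> 0 * (c / (4 / (pi * t)))"
    proof (rule tendsto_mult[OF _ tendsto_divide[OF tendsto_const MK]])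
      show "(\<lambda>n. 1 / real (K n)) \<longlonglongrightarrow> 0" unfolding K_def by real_asymp
    qed (use t in auto)
    moreover have "1 / real (K n) * (c / (real (M n) / (real (K n))\<^sup>2)) = real (K n) * c / real (M n)" for n
      using Kpos(1)[of n] by (simp add: power2_eq_square)
    ultimately have 1: "(\<lambda>n. real (nat \<bar>int (K n) * (2 * k + 1)\<bar>) / real (M n)) \<longlonglongrightarrow> 0"
      unfolding r by simp
    have "(\<lambda>n. c\<^sup>2 / (real (M n) / (real (K n))\<^sup>2)) \<longlonglongrightarrow> c\<^sup>2 / (4 / (pi * t))"
      by (rule tendsto_divide[OF tendsto_const MK]) (use t in simp)
    also have "c\<^sup>2 / (4 / (pi * t)) = pi * t * (of_int k + 1/2)\<^sup>2"
      by (simp add: c_def power2_eq_square algebra_simps)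
    finally have 2: "(\<lambda>n. (real (nat \<bar>int (K n) * (2 * k + 1)\<bar>))\<^sup>2 / real (M n)) \<longlonglongrightarrow> pi * t * (of_int k + 1/2)\<^sup>2"
      unfolding r by (simp add: power_mult_distrib mult.commute)
    have "(\<lambda>n. central_ratio (M n) (nat \<bar>int (K n) * (2 * k + 1)\<bar>)) \<longlonglongrightarrow> exp (- (pi * t * (of_int k + 1/2)\<^sup>2))"
      by (rule central_ratio_tendsto[OF Minf 1 2])
    then have "(\<lambda>n. g n k) \<longlonglongrightarrow> exp (- (pi * t * (of_int k + 1/2)\<^sup>2)) * cos (pi * of_int (2 * k + 1) * m)"
      unfolding g_def by (intro tendsto_intros)
    then show ?thesis by simp
  qed
  \<comment> \<open>From \<open>central_ratio_le_exp\<close> and M <= D * K^2 the exponent is at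
    least (2k + 1)^2 / (2 * D) = (2 / D) * (k + 1/2)^2.\<close>
  have gbound: "\<bar>g n k\<bar> \<le> exp (- (2 / D) * (of_int k + 1/2)\<^sup>2)" for n k
  proof -
    define c where "c = \<bar>real_of_int (2 * k + 1)\<bar>"
    have r: "real (nat \<bar>int (K n) * (2 * k + 1)\<bar>) = real (K n) * c"
      by (simp add: c_def abs_mult)
    have "central_ratio (M n) (nat \<bar>int (K n) * (2 * k + 1)\<bar>) \<le> exp (- (real (K n) * c)\<^sup>2 / (2 * real (M n)))"
      using central_ratio_le_exp[OF Mpos] by (simp only: r[symmetric])
    also have "\<dots> \<le> exp (- (2 / D * (of_int k + 1/2)\<^sup>2))"
    proof -
      have "2 / D * (of_int k + 1/2)\<^sup>2 = (real (K n) * c)\<^sup>2 / (2 * (D * (real (K n))\<^sup>2))"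
        using D Kpos(1)[of n] by (simp add: c_def power_mult_distrib) (simp add: power2_eq_square field_simps)
      also have "\<dots> \<le> (real (K n) * c)\<^sup>2 / (2 * real (M n))"
        using Mup[of n] Mpos[of n] D Kpos(1)[of n] by (intro divide_left_mono mult_left_mono) auto
      finally show ?thesis by simp
    qed
    finally have "central_ratio (M n) (nat \<bar>int (K n) * (2 * k + 1)\<bar>) \<le> exp (- (2 / D * (of_int k + 1/2)\<^sup>2))" .
    then have "\<bar>g n k\<bar> \<le> exp (- (2 / D * (of_int k + 1/2)\<^sup>2)) * 1"
      unfolding g_def abs_mult using central_ratio_nonneg
      by (intro mult_mono) auto
    then show ?thesis by simp
  qed
  have "(\<lambda>n. infsetsum (g n) UNIV) \<longlonglongrightarrow> (\<Sum>\<^sub>ak\<in>UNIV. exp (- (pi * t) * (of_int k + 1/2)\<^sup>2) * cos (pi * of_int (2 * k + 1) * m))"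
    by (rule infsetsum_dominated_convergence[OF glim gbound integrable_gaussian_int]) (use D in simp)
  \<comment> \<open>The central weight behaves like 1 / sqrt (pi * M), and 2 * K / sqrt (pi * M)
    tends to sqrt t for the chosen M. This is the origin of the factor sqrt t.\<close>
  moreover have "(\<lambda>n. 2 * real (K n) * central_weight (M n)) \<longlonglongrightarrow> sqrt t"
  proof -
    have "(\<lambda>n. 2 / sqrt (real (M n) / (real (K n))\<^sup>2) * (central_weight (M n) * sqrt (real (M n)))) \<longlonglongrightarrow> 2 / sqrt (4 / (pi * t)) * (1 / sqrt pi)"
      by (rule tendsto_mult[OF tendsto_divide[OF tendsto_const tendsto_real_sqrt[OF MK]]
        filterlim_compose[OF central_weight_asymp Minf]]) (use t in simp)
    moreover have "2 / sqrt (real (M n) / (real (K n))\<^sup>2) * (central_weight (M n) * sqrt (real (M n))) = 2 * real (K n) * central_weight (M n)" for n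
      using Mpos[of n] by (simp add: real_sqrt_divide)
    moreover have "2 / sqrt (4 / (pi * t)) * (1 / sqrt pi) = sqrt t"
      using t by (simp add: real_sqrt_divide real_sqrt_mult)
    ultimately show ?thesis by simp
  qed
  ultimately have "(\<lambda>n. 2 * real (K n) * central_weight (M n) * infsetsum (g n) UNIV) \<longlonglongrightarrow>
      sqrt t * (\<Sum>\<^sub>ak\<in>UNIV. exp (- (pi * t) * (of_int k + 1/2)\<^sup>2) * cos (pi * of_int (2 * k + 1) * m))"
    by (intro tendsto_mult)
  \<comment> \<open>The identity \<open>sum_cos_power_even\<close> divided by 4^M.\<close>
  moreover have "2 * real (K n) * central_weight (M n) * infsetsum (g n) UNIV = infsetsum (f n) UNIV" for n
  proof -
    have "4 ^ M n * infsetsum (f n) UNIV = (\<Sum>x\<in>W n. 4 ^ M n * ((- 1) ^ nat \<bar>x\<bar> * cos (pi * (of_int x + m) / (2 * real (K n))) ^ (2 * M n)))"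
      unfolding f_def by (subst infsetsum_if_mem_finite) (auto simp: W_def sum_distrib_left)
    also have "\<dots> = (\<Sum>i<2 * K n. cos (pi * (of_int (l n) + real i)) * (2 * cos (pi * (of_int (l n) + real i + m) / (2 * real (K n)))) ^ (2 * M n))"
    proof (rule sum.reindex_bij_witness[where i = "\<lambda>i. l n + int i" and j = "\<lambda>x. nat (x - l n)"])
      fix x assume x: "x \<in> W n"
      then have rx: "of_int (l n) + real (nat (x - l n)) = of_int x" by (simp add: W_def)
      have "cos (pi * of_int x) = (- 1) ^ nat \<bar>x\<bar>"
      proof -
        have "cos (pi * of_int x) = cos (pi * real (nat \<bar>x\<bar>))"
          by (cases "0 \<le> x") (simp_all add: cos_minus[of "pi * _", symmetric] del: cos_minus)
        then show ?thesis by (simp only: cos_npi2)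
      qed
      then show "cos (pi * (of_int (l n) + real (nat (x - l n)))) * (2 * cos (pi * (of_int (l n) + real (nat (x - l n)) + m) / (2 * real (K n)))) ^ (2 * M n) =
          4 ^ M n * ((- 1) ^ nat \<bar>x\<bar> * cos (pi * (of_int x + m) / (2 * real (K n))) ^ (2 * M n))"
        unfolding rx by (simp add: power_mult_distrib power_mult[of 2])
    qed (auto simp: W_def)
    also have "\<dots> = 2 * real (K n) * (\<Sum>\<^sub>ak::int\<in>UNIV. real (2 * M n choose (M n + nat \<bar>int (K n) * (2 * k + 1)\<bar>)) * cos (pi * of_int (2 * k + 1) * m))"
      by (rule sum_cos_power_even[OF Kpos(1)])
    also have "(\<Sum>\<^sub>ak::int\<in>UNIV. real (2 * M n choose (M n + nat \<bar>int (K n) * (2 * k + 1)\<bar>)) * cos (pi * of_int (2 * k + 1) * m))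
      = (\<Sum>\<^sub>ak::int\<in>UNIV. 4 ^ M n * central_weight (M n) * g n k)"
      by (rule infsetsum_cong) (simp_all add: g_def central_ratio_def central_weight_def)
    also have "\<dots> = 4 ^ M n * central_weight (M n) * infsetsum (g n) UNIV"
      unfolding infsetsum_def by (rule integral_mult_right_zero)
    finally have "4 ^ M n * infsetsum (f n) UNIV = 4 ^ M n * (2 * real (K n) * central_weight (M n) * infsetsum (g n) UNIV)"
      by (simp only: mult_ac)
    then show ?thesis by simp
  qed
  ultimately show ?thesis using LIMSEQ_unique[OF flim'] by simp
qed

subsection \<open>Asymptotic expansions\<close>

text \<open>Raising the odd multiple by 2 adds 2 * y to the angle. In the addition formula the sine
  term contains sin (2 * y) = 2 * sin y * cos y and so contributes at most 2 * |cos y|. Negative k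
  follow as the cosine is even.\<close>

lemma abs_cos_odd_multiple_le:
  fixes y :: real
  shows
  "\<bar>cos (of_int (2 * k + 1) * y)\<bar> \<le> \<bar>of_int (2 * k + 1)\<bar> * \<bar>cos y\<bar>"
proof -
  have n: "\<bar>cos ((2 * real n + 1) * y)\<bar> \<le> (2 * real n + 1) * \<bar>cos y\<bar>" for n
  proof (induction n)
    case (Suc n)
    have "(2 * real (Suc n) + 1) * y = (2 * real n + 1) * y + 2 * y" by (simp add: algebra_simps)
    then have "cos ((2 * real (Suc n) + 1) * y) =
        cos ((2 * real n + 1) * y) * cos (2 * y) - 2 * sin ((2 * real n + 1) * y) * sin y * cos y"
      by (simp only: cos_add sin_double)
    also have "\<bar>\<dots>\<bar> \<le> \<bar>cos ((2 * real n + 1) * y) * cos (2 * y)\<bar> + \<bar>2 * sin ((2 * real n + 1) * y) * sin y * cos y\<bar>"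
      by (rule abs_triangle_ineq4)
    also have "\<dots> \<le> \<bar>cos ((2 * real n + 1) * y)\<bar> * 1 + 2 * 1 * 1 * \<bar>cos y\<bar>"
      unfolding abs_mult by (intro add_mono mult_mono) auto
    also have "\<dots> \<le> (2 * real (Suc n) + 1) * \<bar>cos y\<bar>"
      using Suc by (simp add: algebra_simps)
    finally show ?case .
  qed simp
  show ?thesis
  proof (cases "0 \<le> k")
    case True
    then show ?thesis using n[of "nat k"] by simp
  next
    case False
    define j where "j = nat (- k - 1)"
    have "of_int (2 * k + 1) = - (2 * real j + 1)" using False by (simp add: j_def)
    then show ?thesis using n[of j] by (simp only: mult_minus_left cos_minus abs_minus_cancel)
  qed
qed

text \<open>The terms at k and - 1 - k coincide: 0 and - 1 give the leading term, 1 and - 2 the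
  second. All others have |k + 1/2| >= 5/2, so their exponent 25 * pi * t / 4 or more exceeds the
  leading pi * t / 4 by at least 6 * pi * t.\<close>

lemma theta_expansion:
  obtains C where "\<And>t m. 1 \<le> t \<Longrightarrow> \<exists>R. \<bar>R\<bar> \<le> C * exp (- (6 * pi * t)) * \<bar>cos (pi * m)\<bar> \<and>
    theta t m = 2 * sqrt t * exp (- (pi * t / 4)) * (cos (pi * m) + exp (- (2 * pi * t)) * cos (3 * pi * m) + R)"
proof -
  \<comment> \<open>With s = k + 1/2, t >= 1 and s^2 >= 25/4 one has t * s^2 >= 25 * t / 4 + (s^2 -
    25/4). The first part goes into B; the second leaves exp (- pi * s^2), free of t, of which exp
    (- s^2) is spent on the factor |2k + 1| <= exp (s^2) of the cosine bound.\<close>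
  define w where "w k = exp (25 * pi / 4) * exp (- (pi - 1) * (of_int k + 1/2)\<^sup>2)" for k :: int
  define S where "S = {0, - 1, 1, - 2 :: int}"
  define C where "C = infsetsum w (- S) / 2"
  have "integrable (count_space UNIV) w"
    unfolding w_def using pi_gt3 by (intro integrable_mult_right integrable_gaussian_int) auto
  then have wint: "Infinite_Set_Sum.abs_summable_on w UNIV" by (simp add: Infinite_Set_Sum.abs_summable_on_def)
  show thesis
  proof (rule that)
    fix t m :: real assume t: "1 \<le> t"
    define f where "f k = exp (- (pi * t) * (of_int k + 1/2)\<^sup>2) * cos (pi * of_int (2 * k + 1) * m)" for k :: int
    define B where "B = exp (- (25 * pi * t / 4)) * \<bar>cos (pi * m)\<bar>"
    have "integrable (count_space UNIV) (\<lambda>k::int. exp (- (pi * t) * (of_int k + 1/2)\<^sup>2))"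
      using t by (intro integrable_gaussian_int) auto
    then have "integrable (count_space UNIV) f"
      by (rule Bochner_Integration.integrable_bound) (auto simp: f_def abs_mult intro!: mult_left_le)
    then have fint: "Infinite_Set_Sum.abs_summable_on f UNIV" by (simp add: Infinite_Set_Sum.abs_summable_on_def)
    have fbound: "\<bar>f k\<bar> \<le> B * w k" if "k \<in> - S" for k
    proof -
      define s where "s = real_of_int k + 1/2"
      have "k \<ge> 2 \<or> k \<le> - 3" using that by (auto simp: S_def)
      then have "5/2 \<le> \<bar>s\<bar>" unfolding s_def by linarith
      then have "(5/2)\<^sup>2 \<le> \<bar>s\<bar>\<^sup>2" by (intro power_mono) auto
      then have s2: "25/4 \<le> s\<^sup>2" by (simp add: power2_eq_square)
      have "0 \<le> (t - 1) * (s\<^sup>2 - 25/4)" using t s2 by (intro mult_nonneg_nonneg) auto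
      also have "(t - 1) * (s\<^sup>2 - 25/4) = t * s\<^sup>2 - s\<^sup>2 - 25 * t / 4 + 25/4" by (simp add: field_simps)
      finally have "25 * t / 4 - 25/4 + s\<^sup>2 \<le> t * s\<^sup>2" by linarith
      then have "pi * (25 * t / 4 - 25/4 + s\<^sup>2) \<le> pi * (t * s\<^sup>2)" by (intro mult_left_mono) auto
      then have 1: "exp (- (pi * t) * s\<^sup>2) \<le> exp (- (25 * pi * t / 4)) * (exp (25 * pi / 4) * exp (- (pi * s\<^sup>2)))"
        unfolding exp_add[symmetric] by (simp add: algebra_simps)
      have "0 \<le> (\<bar>s\<bar> - 1)\<^sup>2" by simp
      then have "2 * \<bar>s\<bar> \<le> 1 + s\<^sup>2" by (simp add: power2_diff)
      also have "\<dots> \<le> exp (s\<^sup>2)" by (rule exp_ge_add_one_self)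
      finally have "2 * \<bar>s\<bar> \<le> exp (s\<^sup>2)" .
      moreover have "real_of_int (2 * k + 1) = 2 * s" by (simp add: s_def)
      then have "\<bar>real_of_int (2 * k + 1)\<bar> = 2 * \<bar>s\<bar>" by (simp only: abs_mult abs_numeral)
      ultimately have "\<bar>real_of_int (2 * k + 1)\<bar> * \<bar>cos (pi * m)\<bar> \<le> exp (s\<^sup>2) * \<bar>cos (pi * m)\<bar>"
        by (intro mult_right_mono) simp_all
      with abs_cos_odd_multiple_le[of k "pi * m"]
      have "\<bar>cos (of_int (2 * k + 1) * (pi * m))\<bar> \<le> exp (s\<^sup>2) * \<bar>cos (pi * m)\<bar>"
        by (rule order_trans)
      then have 2: "\<bar>cos (pi * of_int (2 * k + 1) * m)\<bar> \<le> exp (s\<^sup>2) * \<bar>cos (pi * m)\<bar>"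
        by (simp only: mult_ac)
      have "\<bar>f k\<bar> = exp (- (pi * t) * s\<^sup>2) * \<bar>cos (pi * of_int (2 * k + 1) * m)\<bar>"
        by (simp only: f_def s_def abs_mult abs_exp_cancel)
      also have "\<dots> \<le> exp (- (25 * pi * t / 4)) * (exp (25 * pi / 4) * exp (- (pi * s\<^sup>2))) * (exp (s\<^sup>2) * \<bar>cos (pi * m)\<bar>)"
        using 1 2 by (rule mult_mono) auto
      also have "\<dots> = B * (exp (25 * pi / 4) * (exp (- (pi * s\<^sup>2)) * exp (s\<^sup>2)))"
        by (simp only: B_def mult_ac)
      also have "exp (- (pi * s\<^sup>2)) * exp (s\<^sup>2) = exp (- (pi - 1) * s\<^sup>2)"
        unfolding exp_add[symmetric] by (simp add: algebra_simps)
      finally show ?thesis by (simp only: w_def s_def)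
    qed
    have sub: "Infinite_Set_Sum.abs_summable_on h (- S)" if "Infinite_Set_Sum.abs_summable_on h UNIV" for h :: "int \<Rightarrow> real"
      using that by (rule Infinite_Set_Sum.abs_summable_on_subset) simp
    have "\<bar>infsetsum f (- S)\<bar> \<le> infsetsum (\<lambda>k. \<bar>f k\<bar>) (- S)"
      using norm_infsetsum_bound[of f "- S"] by simp
    also have "\<dots> \<le> infsetsum (\<lambda>k. B * w k) (- S)"
    proof (rule infsetsum_mono)
      show "Infinite_Set_Sum.abs_summable_on (\<lambda>k. \<bar>f k\<bar>) (- S)"
        using sub[OF fint] Infinite_Set_Sum.abs_summable_on_norm_iff[of f "- S"] by simp
      show "Infinite_Set_Sum.abs_summable_on (\<lambda>k. B * w k) (- S)"
        using sub[OF wint] by (intro Infinite_Set_Sum.abs_summable_on_cmult_right)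
    qed (use fbound in auto)
    also have "\<dots> = 2 * C * B"
      by (simp add: infsetsum_cmult_right[OF sub[OF wint]] C_def)
    finally have rest: "\<bar>infsetsum f (- S)\<bar> \<le> 2 * C * B" .
    have f0: "f 0 = exp (- (pi * t / 4)) * cos (pi * m)" "f (- 1) = exp (- (pi * t / 4)) * cos (pi * m)"
      by (simp_all add: f_def power2_eq_square)
    have f1: "f 1 = exp (- (pi * t / 4)) * (exp (- (2 * pi * t)) * cos (3 * pi * m))"
      "f (- 2) = exp (- (pi * t / 4)) * (exp (- (2 * pi * t)) * cos (3 * pi * m))"
      unfolding mult.assoc[symmetric] exp_add[symmetric] by (simp_all add: f_def power2_eq_square mult_ac)
    have "infsetsum f UNIV = infsetsum f S + infsetsum f (- S)"
      using infsetsum_Diff[OF fint, of S] by (simp add: Compl_eq_Diff_UNIV)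
    also have "infsetsum f S = 2 * exp (- (pi * t / 4)) * (cos (pi * m) + exp (- (2 * pi * t)) * cos (3 * pi * m))"
      by (simp add: S_def f0 f1 algebra_simps)
    finally have "infsetsum f UNIV = 2 * exp (- (pi * t / 4)) * (cos (pi * m) + exp (- (2 * pi * t)) * cos (3 * pi * m) + exp (pi * t / 4) * infsetsum f (- S) / 2)"
      by (simp add: distrib_left exp_minus)
    then have "theta t m = 2 * sqrt t * exp (- (pi * t / 4)) * (cos (pi * m) + exp (- (2 * pi * t)) * cos (3 * pi * m) + exp (pi * t / 4) * infsetsum f (- S) / 2)"
      using t theta_transformation[of t m] by (simp only: f_def[abs_def])
    moreover have "\<bar>exp (pi * t / 4) * infsetsum f (- S) / 2\<bar> \<le> C * exp (- (6 * pi * t)) * \<bar>cos (pi * m)\<bar>"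
    proof -
      have "\<bar>exp (pi * t / 4) * infsetsum f (- S) / 2\<bar> \<le> exp (pi * t / 4) * (2 * C * B) / 2"
        using rest by (simp add: abs_mult)
      also have "\<dots> = C * (exp (pi * t / 4) * exp (- (25 * pi * t / 4))) * \<bar>cos (pi * m)\<bar>"
        by (simp add: B_def)
      also have "exp (pi * t / 4) * exp (- (25 * pi * t / 4)) = exp (- (6 * pi * t))"
        unfolding exp_add[symmetric] by simp
      finally show ?thesis .
    qed
    ultimately show "\<exists>R. \<bar>R\<bar> \<le> C * exp (- (6 * pi * t)) * \<bar>cos (pi * m)\<bar> \<and>
      theta t m = 2 * sqrt t * exp (- (pi * t / 4)) * (cos (pi * m) + exp (- (2 * pi * t)) * cos (3 * pi * m) + R)"
      by blast
  qed
qed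

lemma theta_leading_term:
  obtains C where "\<And>t m. 1 \<le> t \<Longrightarrow> \<exists>R. \<bar>R\<bar> \<le> C * exp (- (2 * pi * t)) \<and>
    theta t m = 2 * sqrt t * exp (- (pi * t / 4)) * cos (pi * m) * (1 + R)"
proof -
  obtain C where C: "\<And>t m. 1 \<le> t \<Longrightarrow> \<exists>R. \<bar>R\<bar> \<le> C * exp (- (6 * pi * t)) * \<bar>cos (pi * m)\<bar> \<and>
    theta t m = 2 * sqrt t * exp (- (pi * t / 4)) * (cos (pi * m) + exp (- (2 * pi * t)) * cos (3 * pi * m) + R)"
    using theta_expansion by blast
  show thesis
  proof (rule that)
    fix t m :: real assume t: "1 \<le> t"
    obtain R where R: "\<bar>R\<bar> \<le> C * exp (- (6 * pi * t)) * \<bar>cos (pi * m)\<bar>"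
      and th: "theta t m = 2 * sqrt t * exp (- (pi * t / 4)) * (cos (pi * m) + exp (- (2 * pi * t)) * cos (3 * pi * m) + R)"
      using C[OF t] by blast
    have "\<bar>R\<bar> \<le> \<bar>C\<bar> * exp (- (2 * pi * t)) * \<bar>cos (pi * m)\<bar>"
    proof -
      have "C * exp (- (6 * pi * t)) \<le> \<bar>C\<bar> * exp (- (2 * pi * t))"
        using t by (intro mult_mono) auto
      then show ?thesis using R by (meson abs_ge_zero mult_right_mono order_trans)
    qed
    moreover have "\<bar>cos (3 * pi * m)\<bar> \<le> 3 * \<bar>cos (pi * m)\<bar>"
      using abs_cos_odd_multiple_le[of 1 "pi * m"] by (simp add: mult.assoc)
    then have "\<bar>exp (- (2 * pi * t)) * cos (3 * pi * m)\<bar> \<le> exp (- (2 * pi * t)) * (3 * \<bar>cos (pi * m)\<bar>)"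
      by (simp add: abs_mult)
    ultimately have b: "\<bar>exp (- (2 * pi * t)) * cos (3 * pi * m) + R\<bar> \<le> (3 + \<bar>C\<bar>) * exp (- (2 * pi * t)) * \<bar>cos (pi * m)\<bar>"
      by (simp add: algebra_simps)
    \<comment> \<open>If the cosine vanishes, the bound b forces the numerator to be 0 and the
      quotient is 0 by convention, so the factorisation below holds in every case.\<close>
    define R' where "R' = (exp (- (2 * pi * t)) * cos (3 * pi * m) + R) / cos (pi * m)"
    have "x + z = x * (1 + z / x)" if "x \<noteq> 0 \<or> z = 0" for x z :: real
      using that by (auto simp: distrib_left)
    then have "cos (pi * m) + (exp (- (2 * pi * t)) * cos (3 * pi * m) + R) = cos (pi * m) * (1 + R')"
      unfolding R'_def using b by (metis abs_eq_0 abs_ge_zero mult_zero_right order_antisym)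
    then have "theta t m = 2 * sqrt t * exp (- (pi * t / 4)) * cos (pi * m) * (1 + R')"
      unfolding th by (simp only: mult.assoc add.assoc)
    moreover have "\<bar>R'\<bar> \<le> (3 + \<bar>C\<bar>) * exp (- (2 * pi * t))"
    proof (cases "cos (pi * m) = 0")
      case False
      then show ?thesis using b by (simp add: R'_def abs_divide pos_divide_le_eq)
    qed (simp add: R'_def)
    ultimately show "\<exists>R. \<bar>R\<bar> \<le> (3 + \<bar>C\<bar>) * exp (- (2 * pi * t)) \<and>
      theta t m = 2 * sqrt t * exp (- (pi * t / 4)) * cos (pi * m) * (1 + R)" by blast
  qed
qed

section \<open>The Euler product (q; q)\<close>

lemma qpoch_inf_trisection:
  assumes q01: "0 < q" "q < 1"
  shows "qpoch_inf q (q ^ 3) * qpoch_inf (q ^ 2) (q ^ 3) * qpoch_inf (q ^ 3) (q ^ 3) = qpoch_inf q q"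
proof -
  have Q01: "0 < q ^ 3" "q ^ 3 < 1" using q01 by (simp_all add: power_less_one_iff)
  have p: "(\<Prod>i<3 * n. 1 - q * q ^ i) = (\<Prod>i<n. 1 - q * (q ^ 3) ^ i) * (\<Prod>i<n. 1 - q ^ 2 * (q ^ 3) ^ i) * (\<Prod>i<n. 1 - q ^ 3 * (q ^ 3) ^ i)" for n
  proof (induction n)
    case (Suc n)
    have "3 * Suc n = Suc (Suc (Suc (3 * n)))" by simp
    then have "(\<Prod>i<3 * Suc n. 1 - q * q ^ i) = (\<Prod>i<3 * n. 1 - q * q ^ i) * (1 - q * q ^ (3 * n)) * (1 - q * q ^ Suc (3 * n)) * (1 - q * q ^ Suc (Suc (3 * n)))"
      by (simp only: prod.lessThan_Suc)
    also have "q * q ^ (3 * n) = q * (q ^ 3) ^ n" by (simp add: power_mult)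
    also have "q * q ^ Suc (3 * n) = q ^ 2 * (q ^ 3) ^ n" by (simp add: power_mult power2_eq_square)
    also have "q * q ^ Suc (Suc (3 * n)) = q ^ 3 * (q ^ 3) ^ n" by (simp add: power_mult power3_eq_cube)
    finally show ?case unfolding Suc.IH by simp
  qed simp
  have "filterlim (\<lambda>n::nat. 3 * n) at_top sequentially"
    by (rule filterlim_at_top_mono[OF filterlim_ident]) auto
  then have "(\<lambda>n. \<Prod>i<3 * n. 1 - q * q ^ i) \<longlonglongrightarrow> qpoch_inf q q"
    by (rule filterlim_compose[OF qpoch_inf_LIMSEQ[OF q01]])
  moreover have "(\<lambda>n. \<Prod>i<3 * n. 1 - q * q ^ i) \<longlonglongrightarrow> qpoch_inf q (q ^ 3) * qpoch_inf (q ^ 2) (q ^ 3) * qpoch_inf (q ^ 3) (q ^ 3)"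
    unfolding p by (intro tendsto_mult qpoch_inf_LIMSEQ Q01)
  ultimately show ?thesis by (rule LIMSEQ_unique[rotated])
qed

text \<open>Euler's pentagonal number theorem turns the modular behaviour of \<^const>\<open>theta\<close> into that of the eta function.\<close>

lemma qpoch_inf_eq_theta:
  assumes t: "0 < t" and q: "q = exp (- 2 * pi / t)"
  shows "qpoch_inf q q = exp (pi / (12 * t)) * theta (t / 3) (1/6)"
proof -
  have q01: "0 < q" "q < 1" using t by (auto simp: q)
  have Q: "q ^ 3 = exp (- 2 * pi / (t / 3))"
    unfolding q exp_of_nat_mult[symmetric] by simp
  have "q ^ 3 = q powr 3" "q ^ 2 = q powr 2" using q01 by simp_all
  \<comment> \<open>The shift 1/6 is the one for which the base q^3 yields the exponents 1 and 2,
    the two residue classes modulo 3 that (q^3; q^3) omits.\<close>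
  then have "(q ^ 3) powr (1/2 + 1/6) = q ^ 2" "(q ^ 3) powr (1/2 - 1/6) = q"
    using q01 by (simp_all only: powr_powr) simp_all
  then have "qpoch_inf (q ^ 2) (q ^ 3) * qpoch_inf q (q ^ 3) * qpoch_inf (q ^ 3) (q ^ 3)
      = exp (pi * (1/6)\<^sup>2 / (t / 3)) * theta (t / 3) (1/6)"
    using jacobi_triple_product[OF _ Q, of "1/6"] t by simp
  also have "pi * (1/6)\<^sup>2 / (t / 3) = pi / (12 * t)" by (simp add: power2_eq_square)
  finally show ?thesis using qpoch_inf_trisection[OF q01] by (simp only: mult_ac)
qed

text \<open>Theta is expanded at t/3, hence the assumption 3 <= t. There 2 * sqrt (t/3) * cos (pi/6)
  = sqrt t, and the remainder is of order exp (- 6 * pi * (t/3)).\<close>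

lemma qpoch_inf_leading_term:
  obtains C where "\<And>t q. 3 \<le> t \<Longrightarrow> q = exp (- 2 * pi / t) \<Longrightarrow> \<exists>R. \<bar>R\<bar> \<le> C * exp (- (2 * pi * t)) \<and>
    qpoch_inf q q = sqrt t * exp (pi / (12 * t) - pi * t / 12) * (1 + R)"
proof -
  obtain C where C: "\<And>t m. 1 \<le> t \<Longrightarrow> \<exists>R. \<bar>R\<bar> \<le> C * exp (- (6 * pi * t)) * \<bar>cos (pi * m)\<bar> \<and>
    theta t m = 2 * sqrt t * exp (- (pi * t / 4)) * (cos (pi * m) + exp (- (2 * pi * t)) * cos (3 * pi * m) + R)"
    using theta_expansion by blast
  show thesis
  proof (rule that)
    fix t q :: real assume t: "3 \<le> t" and q: "q = exp (- 2 * pi / t)"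
    have c: "cos (pi * (1/6)) = sqrt 3 / 2" "cos (3 * pi * (1/6)) = 0"
      by (simp_all add: cos_30)
    obtain R where R: "\<bar>R\<bar> \<le> C * exp (- (6 * pi * (t / 3))) * \<bar>cos (pi * (1/6))\<bar>"
      and th: "theta (t / 3) (1/6) = 2 * sqrt (t / 3) * exp (- (pi * (t / 3) / 4)) * (cos (pi * (1/6)) + exp (- (2 * pi * (t / 3))) * cos (3 * pi * (1/6)) + R)"
      using C[of "t / 3" "1/6"] t by auto
    have "theta (t / 3) (1/6) = sqrt t * exp (- (pi * t / 12)) * (1 + 2 * R / sqrt 3)"
      unfolding th c by (simp add: real_sqrt_divide field_simps)
    moreover have "qpoch_inf q q = exp (pi / (12 * t)) * theta (t / 3) (1/6)"
      using t by (intro qpoch_inf_eq_theta q) simp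
    moreover have "exp (pi / (12 * t) - pi * t / 12) = exp (pi / (12 * t)) * exp (- (pi * t / 12))"
      by (simp only: exp_add[symmetric] diff_conv_add_uminus)
    ultimately have "qpoch_inf q q = sqrt t * exp (pi / (12 * t) - pi * t / 12) * (1 + 2 * R / sqrt 3)"
      by (simp only: mult_ac)
    moreover have "\<bar>2 * R / sqrt 3\<bar> \<le> C * exp (- (2 * pi * t))"
    proof -
      have "2 * \<bar>R\<bar> \<le> C * exp (- (2 * pi * t)) * sqrt 3"
        using R unfolding c by (simp add: mult_ac)
      then show ?thesis by (simp add: abs_mult pos_divide_le_eq)
    qed
    ultimately show "\<exists>R. \<bar>R\<bar> \<le> C * exp (- (2 * pi * t)) \<and>
      qpoch_inf q q = sqrt t * exp (pi / (12 * t) - pi * t / 12) * (1 + R)" by blast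
  qed
qed

section \<open>Calculus of relative errors\<close>

text \<open>Here f * h - 1 = (f - 1) * (h - 1) + (f - 1) + (h - 1), and f - 1 is bounded in the
  first product because g tends to 0.\<close>

lemma mult_minus_one_bigo:
  fixes f h g :: "nat \<Rightarrow> real"
  assumes g: "g \<longlonglongrightarrow> 0" and f: "(\<lambda>n. f n - 1) \<in> O(g)" and h: "(\<lambda>n. h n - 1) \<in> O(g)"
  shows "(\<lambda>n. f n * h n - 1) \<in> O(g)"
proof -
  have "g \<in> O(\<lambda>_. 1)" using g by (intro bigoI_tendsto[where c = 0]) auto
  then have "(\<lambda>n. f n - 1) \<in> O(\<lambda>_. 1)" using f landau_o.big_trans by blast
  then have "(\<lambda>n. (f n - 1) * (h n - 1)) \<in> O(\<lambda>n. 1 * g n)" using h by (rule landau_o.big.mult)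
  then have "(\<lambda>n. (f n - 1) * (h n - 1)) \<in> O(g)" by simp
  then have "(\<lambda>n. (f n - 1) * (h n - 1) + (f n - 1) + (h n - 1)) \<in> O(g)"
    by (rule sum_in_bigo(1)[OF sum_in_bigo(1)[OF _ f] h])
  then show ?thesis by (simp add: algebra_simps)
qed

text \<open>Here 1/f - 1 = - (1/f) * (f - 1) eventually, with 1/f bounded since f tends to
  1.\<close>

lemma inverse_minus_one_bigo:
  fixes f g :: "nat \<Rightarrow> real"
  assumes g: "g \<longlonglongrightarrow> 0" and f: "(\<lambda>n. f n - 1) \<in> O(g)"
  shows "(\<lambda>n. 1 / f n - 1) \<in> O(g)"
proof -
  have "g \<in> o(\<lambda>_. 1)" using g by (intro smalloI_tendsto) auto
  with f have "(\<lambda>n. f n - 1) \<in> o(\<lambda>_. 1)" by (rule landau_o.big_small_trans)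
  then have "(\<lambda>n. f n - 1) \<longlonglongrightarrow> 0" by (auto dest: smalloD_tendsto)
  then have f1: "f \<longlonglongrightarrow> 1" by (simp add: LIM_zero_iff)
  then have "(\<lambda>n. 1 / f n) \<longlonglongrightarrow> 1 / 1" by (intro tendsto_intros) auto
  then have "(\<lambda>n. 1 / f n) \<in> O(\<lambda>_. 1)" by (intro bigoI_tendsto[where c = 1]) auto
  then have "(\<lambda>n. - (1 / f n) * (f n - 1)) \<in> O(\<lambda>n. 1 * g n)"
    by (intro landau_o.big.mult f) auto
  moreover have "\<forall>\<^sub>F n in sequentially. - (1 / f n) * (f n - 1) = 1 / f n - 1"
  proof -
    have "\<forall>\<^sub>F n in sequentially. f n \<noteq> 0" using tendsto_imp_eventually_ne[OF f1] by simp
    then show ?thesis by eventually_elim (simp add: field_simps)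
  qed
  ultimately show ?thesis using landau_o.big.in_cong by force
qed

text \<open>By \<open>qpoch_inf_bounds\<close> the deviation is at most q^(1/2 + m) / (1 - q),
  roughly n^a * exp (- 2 * pi * n^(1 - a)) up to constants. As 1 - a > a, this is negligible against
  exp (- 2 * pi * n^a) despite the power of n.\<close>

lemma qpoch_inf_tail_bigo:
  fixes a u :: real
  assumes a: "0 < a" "a < 1/2"
  shows "(\<lambda>n. qpoch_inf (exp (- 2 * pi * real n powr (- a)) powr (1/2 + (real n + real n powr a * u))) (exp (- 2 * pi * real n powr (- a))) - 1)
    \<in> O(\<lambda>n. exp (- 2 * pi * real n powr a))"
proof -
  define t where "t n = real n powr a" for n
  define c where "c n = exp (- (2 * pi / t n) * (1/2 + (real n + t n * u)))" for n
  \<comment> \<open>The first factor bounds 1 / (1 - q): with z = 2 * pi / t, exp (- z) <= 1 / (1 +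
    z) gives 1 / (1 - exp (- z)) <= 1 + 1/z. The dependence on u goes into the constant exp (2 * pi
    * |u|).\<close>
  define b where "b n = (1 + real n powr a / (2 * pi)) * exp (- 2 * pi * real n powr (1 - a))" for n
  have b: "b \<in> O(\<lambda>n. exp (- 2 * pi * real n powr a))"
    unfolding b_def using a by real_asymp
  have b0: "b \<longlonglongrightarrow> 0"
    unfolding b_def using a by real_asymp
  have cb: "c n / (1 - exp (- (2 * pi / t n))) \<le> exp (2 * pi * \<bar>u\<bar>) * b n" "0 \<le> c n" "c n \<le> exp (2 * pi * \<bar>u\<bar>) * b n" if n: "0 < n" for n
  proof -
    have t: "0 < t n" using n by (simp add: t_def)
    have "- (2 * pi / t n) * (1/2 + (real n + t n * u)) = - (pi / t n) + - 2 * pi * u + - 2 * pi * (real n / t n)"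
      using t by (simp add: field_simps)
    also have "\<dots> \<le> 2 * pi * \<bar>u\<bar> + - 2 * pi * (real n / t n)"
    proof -
      have "2 * pi * - u \<le> 2 * pi * \<bar>u\<bar>" by (intro mult_left_mono) auto
      moreover have "0 \<le> pi / t n" using t by simp
      ultimately show ?thesis by linarith
    qed
    also have "real n / t n = real n powr (1 - a)"
      using n by (simp add: t_def powr_diff)
    finally have c: "c n \<le> exp (2 * pi * \<bar>u\<bar>) * exp (- 2 * pi * real n powr (1 - a))"
      unfolding c_def exp_add[symmetric] by simp
    define z where "z = 2 * pi / t n"
    have z: "0 < z" using t by (simp add: z_def)
    have "exp (- z) \<le> 1 / (1 + z)"
      using exp_ge_add_one_self[of z] z unfolding exp_minus inverse_eq_divide by (intro divide_left_mono) auto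
    then have "z / (1 + z) \<le> 1 - exp (- z)" using z by (simp add: field_simps)
    then have "1 / (1 - exp (- z)) \<le> 1 / (z / (1 + z))"
      using z by (intro divide_left_mono) (auto intro!: mult_pos_pos divide_pos_pos)
    also have "\<dots> = 1 + real n powr a / (2 * pi)"
      using z t by (simp add: z_def t_def field_simps)
    finally have i: "1 / (1 - exp (- z)) \<le> 1 + real n powr a / (2 * pi)" .
    have "c n * (1 / (1 - exp (- z))) \<le> exp (2 * pi * \<bar>u\<bar>) * exp (- 2 * pi * real n powr (1 - a)) * (1 + real n powr a / (2 * pi))"
      using c i z by (intro mult_mono) auto
    then show "c n / (1 - exp (- (2 * pi / t n))) \<le> exp (2 * pi * \<bar>u\<bar>) * b n"
      by (simp add: z_def b_def mult_ac)
    show "0 \<le> c n" by (simp add: c_def)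
    \<comment> \<open>This bound yields c <= 1 eventually, which \<open>qpoch_inf_bounds\<close>
      requires.\<close>
    have "exp (2 * pi * \<bar>u\<bar>) * exp (- 2 * pi * real n powr (1 - a)) * 1 \<le> exp (2 * pi * \<bar>u\<bar>) * exp (- 2 * pi * real n powr (1 - a)) * (1 + real n powr a / (2 * pi))"
      by (intro mult_left_mono) auto
    moreover have "exp (2 * pi * \<bar>u\<bar>) * exp (- 2 * pi * real n powr (1 - a)) * (1 + real n powr a / (2 * pi)) = exp (2 * pi * \<bar>u\<bar>) * b n"
      by (simp only: b_def mult_ac)
    ultimately show "c n \<le> exp (2 * pi * \<bar>u\<bar>) * b n" using c by linarith
  qed
  have "(\<lambda>n. exp (2 * pi * \<bar>u\<bar>) * b n) \<longlonglongrightarrow> exp (2 * pi * \<bar>u\<bar>) * 0" by (intro tendsto_intros b0)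
  then have "\<forall>\<^sub>F n in sequentially. exp (2 * pi * \<bar>u\<bar>) * b n < 1" by (rule order_tendstoD) simp
  then have "\<forall>\<^sub>F n in sequentially. norm (qpoch_inf (exp (- 2 * pi * real n powr (- a)) powr (1/2 + (real n + real n powr a * u))) (exp (- 2 * pi * real n powr (- a))) - 1)
     \<le> exp (2 * pi * \<bar>u\<bar>) * norm (b n)"
    using eventually_gt_at_top[of 0]
  proof eventually_elim
    case (elim n)
    have e: "- 2 * pi * real n powr (- a) = - (2 * pi / t n)"
      by (simp add: t_def powr_minus_divide)
    have "exp (- (2 * pi / t n)) powr (1/2 + (real n + t n * u)) = c n"
      by (simp add: c_def powr_def mult.commute)
    moreover have "0 < t n" using elim by (simp add: t_def)
    moreover have "c n \<le> 1" using cb(3)[OF elim(2)] elim(1) by linarith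
    ultimately have "\<bar>qpoch_inf (exp (- (2 * pi / t n)) powr (1/2 + (real n + t n * u))) (exp (- (2 * pi / t n))) - 1\<bar> \<le> c n / (1 - exp (- (2 * pi / t n)))"
      using qpoch_inf_bounds[of "exp (- (2 * pi / t n))" "c n"] cb(2)[OF elim(2)] by simp
    moreover have "0 \<le> b n" by (simp add: b_def)
    ultimately show ?case unfolding e t_def[symmetric] using cb(1)[OF elim(2)] by simp
  qed
  then have "(\<lambda>n. qpoch_inf (exp (- 2 * pi * real n powr (- a)) powr (1/2 + (real n + real n powr a * u))) (exp (- 2 * pi * real n powr (- a))) - 1) \<in> O(b)"
    by (rule bigoI)
  then show ?thesis using b by (rule landau_o.big_trans)
qed


section \<open>Assembling the two expansions\<close>

theorem theorem2p2:
  fixes a u :: real and q :: "nat \<Rightarrow> real"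
  assumes a: "0 < a" "a < 1/2"
    and q: "\<And>n. q n = exp (- 2 * pi * real n powr (- a))"
  shows "(\<exists>h \<in> O(\<lambda>n::nat. exp (- 2 * pi * real n powr a)). \<forall>\<^sub>F n in sequentially.
           rq_Gamma (q n) (1/2 - real n - real n powr a * u) =
             (2 * (- 1) ^ n * exp (pi * real n powr (- a) * (real n powr a * u + real n)\<^sup>2)
                * cos (pi * real n powr a * u) * (1 + h n))
             / (sqrt (real n powr a) * exp (pi * real n powr a / 12 + pi * real n powr (- a) / 6)
                * (1 - exp (- 2 * pi * real n powr (- a))) powr (real n + real n powr a * u + 1/2)))
    \<and> (\<exists>h \<in> O(\<lambda>n::nat. exp (- 2 * pi * real n powr a)). \<forall>\<^sub>F n in sequentially.
           rq_Gamma (q n) (1/2 + real n + real n powr a * u) =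
             (exp (pi * real n powr a / 12 - pi * real n powr (- a) / 12) * (1 + h n))
             / (sqrt (real n powr a)
                * (1 - exp (- 2 * pi * real n powr (- a))) powr (1/2 - real n - real n powr a * u)))"
proof -
  define t where "t n = real n powr a" for n
  define m where "m n = real n + t n * u" for n
  define g where "g n = exp (- 2 * pi * real n powr a)" for n
  define X where "X n = exp (pi / (12 * t n) - pi * t n / 12)" for n
  define Y where "Y n = qpoch_inf (q n powr (1/2 + m n)) (q n)" for n
  define Z where "Z n = qpoch_inf (q n powr (1/2 - m n)) (q n)" for n
  define E where "E n = qpoch_inf (q n) (q n)" for n
  have nmt: "real n powr (- a) = 1 / t n" for n by (simp add: t_def powr_minus_divide)
  have qt: "q n = exp (- 2 * pi / t n)" for n by (simp add: q nmt)
  have g0: "g \<longlonglongrightarrow> 0" unfolding g_def using a by real_asymp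
  have "filterlim t at_top sequentially" unfolding t_def using a by real_asymp
  then have t3: "\<forall>\<^sub>F n in sequentially. 3 \<le> t n" unfolding filterlim_at_top by blast

  obtain C1 where "\<And>t m. 1 \<le> t \<Longrightarrow> \<exists>R. \<bar>R\<bar> \<le> C1 * exp (- (2 * pi * t)) \<and>
      theta t m = 2 * sqrt t * exp (- (pi * t / 4)) * cos (pi * m) * (1 + R)"
    using theta_leading_term by blast
  \<comment> \<open>The condition on t stands below the quantifier so that the remainder can be
    chosen as a function of all n.\<close>
  then have "\<forall>n. \<exists>R. 3 \<le> t n \<longrightarrow> \<bar>R\<bar> \<le> C1 * exp (- (2 * pi * t n)) \<and>
      theta (t n) (m n) = 2 * sqrt (t n) * exp (- (pi * t n / 4)) * cos (pi * m n) * (1 + R)"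
    by (metis order_trans one_le_numeral)
  then obtain R1 where R1: "\<And>n. 3 \<le> t n \<Longrightarrow> \<bar>R1 n\<bar> \<le> C1 * exp (- (2 * pi * t n))"
      "\<And>n. 3 \<le> t n \<Longrightarrow> theta (t n) (m n) = 2 * sqrt (t n) * exp (- (pi * t n / 4)) * cos (pi * m n) * (1 + R1 n)"
    by metis
  obtain C2 where "\<And>t q. 3 \<le> t \<Longrightarrow> q = exp (- 2 * pi / t) \<Longrightarrow> \<exists>R. \<bar>R\<bar> \<le> C2 * exp (- (2 * pi * t)) \<and>
      qpoch_inf q q = sqrt t * exp (pi / (12 * t) - pi * t / 12) * (1 + R)"
    using qpoch_inf_leading_term by blast
  then have "\<forall>n. \<exists>R. 3 \<le> t n \<longrightarrow> \<bar>R\<bar> \<le> C2 * exp (- (2 * pi * t n)) \<and> E n = sqrt (t n) * X n * (1 + R)"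
    unfolding E_def X_def using qt by blast
  then obtain R2 where R2: "\<And>n. 3 \<le> t n \<Longrightarrow> \<bar>R2 n\<bar> \<le> C2 * exp (- (2 * pi * t n))"
      "\<And>n. 3 \<le> t n \<Longrightarrow> E n = sqrt (t n) * X n * (1 + R2 n)"
    by metis
  have OR1: "(\<lambda>n. 1 + R1 n - 1) \<in> O(g)"
    by (rule bigoI[where c = C1], rule eventually_mono[OF t3]) (use R1(1) in \<open>simp add: g_def t_def mult.assoc\<close>)
  have "(\<lambda>n. 1 + R2 n - 1) \<in> O(g)"
    by (rule bigoI[where c = C2], rule eventually_mono[OF t3]) (use R2(1) in \<open>simp add: g_def t_def mult.assoc\<close>)
  then have O2: "(\<lambda>n. 1 / (1 + R2 n) - 1) \<in> O(g)" by (rule inverse_minus_one_bigo[OF g0])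
  have OY: "(\<lambda>n. Y n - 1) \<in> O(g)"
    unfolding Y_def m_def t_def q g_def[abs_def] by (rule qpoch_inf_tail_bigo[OF a])
  from OY have OY': "(\<lambda>n. 1 / Y n - 1) \<in> O(g)" by (rule inverse_minus_one_bigo[OF g0])
  \<comment> \<open>The triple product gives Z / E = G * theta / (Y * E^2), whose relative error is
    (1 + R1) / (Y * (1 + R2)^2); the second formula involves only Y / E.\<close>
  have O1: "(\<lambda>n. ((1 + R1 n) * (1 / Y n)) * ((1 / (1 + R2 n)) * (1 / (1 + R2 n))) - 1) \<in> O(g)"
    and O3: "(\<lambda>n. Y n * (1 / (1 + R2 n)) - 1) \<in> O(g)"
    by (intro mult_minus_one_bigo[OF g0] OR1 O2 OY OY')+
  have q01: "0 < q n" "q n < 1" if "3 \<le> t n" for n using that by (auto simp: qt)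
  have Epos: "0 < E n" if "3 \<le> t n" for n
    unfolding E_def using q01[OF that] by (intro qpoch_inf_pos) auto
  \<comment> \<open>Isolating Z divides by Y, which is eventually positive because it tends to
    1.\<close>
  have Ypos: "\<forall>\<^sub>F n in sequentially. 3 \<le> t n \<and> 0 < Y n"
  proof -
    have "g \<in> o(\<lambda>_. 1)" using g0 by (intro smalloI_tendsto) auto
    with OY have "(\<lambda>n. Y n - 1) \<in> o(\<lambda>_. 1)" by (rule landau_o.big_small_trans)
    then have "(\<lambda>n. Y n - 1) \<longlonglongrightarrow> 0" by (auto dest: smalloD_tendsto)
    then have "\<forall>\<^sub>F n in sequentially. - 1 < Y n - 1" by (rule order_tendstoD) simp
    with t3 show ?thesis by eventually_elim simp
  qed

  have first: "\<forall>\<^sub>F n in sequentially. rq_Gamma (q n) (1/2 - real n - real n powr a * u) =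
             (2 * (- 1) ^ n * exp (pi * real n powr (- a) * (real n powr a * u + real n)\<^sup>2)
                * cos (pi * real n powr a * u) * (1 + (((1 + R1 n) * (1 / Y n)) * ((1 / (1 + R2 n)) * (1 / (1 + R2 n))) - 1)))
             / (sqrt (real n powr a) * exp (pi * real n powr a / 12 + pi * real n powr (- a) / 6)
                * (1 - exp (- 2 * pi * real n powr (- a))) powr (real n + real n powr a * u + 1/2))"
    using Ypos
  proof eventually_elim
    case (elim n)
    then have t: "3 \<le> t n" and Y: "Y n \<noteq> 0" by auto
    define P where "P = (1 - q n) powr (m n + 1/2)"
    define G where "G = exp (pi / t n * (m n)\<^sup>2)"
    define D where "D = exp (pi * t n / 12 + pi / t n / 6)"
    have jtp: "Y n * Z n * E n = G * (2 * sqrt (t n) * exp (- (pi * t n / 4)) * ((- 1) ^ n * cos (pi * t n * u)) * (1 + R1 n))"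
    proof -
      have "Y n * Z n * E n = exp (pi * (m n)\<^sup>2 / t n) * theta (t n) (m n)"
        unfolding Y_def Z_def E_def using t by (intro jacobi_triple_product qt) auto
      moreover have "cos (pi * m n) = (- 1) ^ n * cos (pi * t n * u)"
        by (simp add: m_def distrib_left cos_add mult.assoc)
      ultimately show ?thesis using R1(2)[OF t] by (simp add: G_def)
    qed
    \<comment> \<open>The exponents are arranged so that X^2 cancels against E^2 and exactly 1 / D
      remains, as in the claimed denominator.\<close>
    have e4: "exp (- (pi * t n / 4)) = X n * X n / D"
      using t unfolding X_def D_def exp_add[symmetric] exp_diff[symmetric]
      by (simp add: field_simps)
    have nz: "sqrt (t n) \<noteq> 0" "X n \<noteq> 0" "D \<noteq> 0" "1 + R2 n \<noteq> 0"
      using t Epos[OF t] R2(2)[OF t] by (auto simp: X_def D_def)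
    have "Z n = (Y n * Z n * E n) / (Y n * E n)" using Y Epos[OF t] by simp
    then have "Z n = G * (2 * sqrt (t n) * (X n * X n / D) * ((- 1) ^ n * cos (pi * t n * u)) * (1 + R1 n)) / (Y n * E n)"
      by (simp only: jtp e4)
    then have "Z n / E n * (1 / P) = G * (2 * sqrt (t n) * (X n * X n / D) * ((- 1) ^ n * cos (pi * t n * u)) * (1 + R1 n)) / (Y n * E n) / E n * (1 / P)"
      by (simp only:)
    also have "\<dots> = (2 * (- 1) ^ n * G * cos (pi * t n * u) * ((1 + R1 n) * (1 / Y n) * ((1 / (1 + R2 n)) * (1 / (1 + R2 n))))) / (sqrt (t n) * D * P)"
      unfolding R2(2)[OF t] using nz Y by simp (simp add: mult_ac)
    finally have main: "Z n / E n * (1 / P) = \<dots>" .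
    have P: "(1 - q n) powr (1/2 - m n - 1) = 1 / P"
      unfolding P_def powr_minus_divide[symmetric] by (simp add: algebra_simps)
    have "rq_Gamma (q n) (1/2 - real n - real n powr a * u) = rq_Gamma (q n) (1/2 - m n)"
      by (simp add: m_def t_def algebra_simps)
    also have "\<dots> = Z n / E n * (1 / P)"
      by (simp only: rq_Gamma_def Z_def E_def P)
    finally show ?case
      unfolding main nmt by (simp add: P_def G_def D_def qt m_def t_def[symmetric] add_ac)
  qed
  have second: "\<forall>\<^sub>F n in sequentially. rq_Gamma (q n) (1/2 + real n + real n powr a * u) =
             (exp (pi * real n powr a / 12 - pi * real n powr (- a) / 12) * (1 + (Y n * (1 / (1 + R2 n)) - 1)))
             / (sqrt (real n powr a)
                * (1 - exp (- 2 * pi * real n powr (- a))) powr (1/2 - real n - real n powr a * u))"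
    using t3
  proof eventually_elim
    case (elim n)
    define P where "P = (1 - q n) powr (1/2 - m n)"
    define X' where "X' = exp (pi * t n / 12 - pi / t n / 12)"
    have "X n * X' = 1"
      unfolding X_def X'_def exp_add[symmetric] by simp
    then have X': "1 / X n = X'" by (metis mult_zero_left nonzero_mult_div_cancel_left zero_neq_one)
    have P: "(1 - q n) powr (1/2 + m n - 1) = 1 / P"
      unfolding P_def powr_minus_divide[symmetric] by (simp add: algebra_simps)
    have "rq_Gamma (q n) (1/2 + real n + real n powr a * u) = rq_Gamma (q n) (1/2 + m n)"
      by (simp add: m_def t_def algebra_simps)
    also have "\<dots> = Y n / E n * (1 / P)"
      by (simp only: rq_Gamma_def Y_def E_def P)
    also have "\<dots> = (X' * (Y n * (1 / (1 + R2 n)))) / (sqrt (t n) * P)"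
      unfolding R2(2)[OF elim] X'[symmetric] by simp
    finally show ?case
      unfolding nmt by (simp add: P_def X'_def qt m_def t_def[symmetric] diff_diff_eq)
  qed
  show ?thesis
    by (rule conjI)
      (rule bexI[OF _ O1[unfolded g_def[abs_def]]], rule first, rule bexI[OF _ O3[unfolded g_def[abs_def]]], rule second)
qed

end
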